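(* Let $\Gamma_1,\dots,\Gamma_k$ be graphs with $d$ vertices (loops and multiple edges allowed) and let $W_1\le S_d,\dots,W_k\le S_d$ be their automorphism groups, respectively. If the permutation group $W_1$ is cyclic, then the number of all superpositions of $\Gamma_1,\dots,\Gamma_k$ having trivial automorphism group is $$ N\bigl(Z(\varrho;p_1,\dots,p_d)\ast Z(1_{W_2};p_1,\dots,p_d)\ast\cdots\ast Z(1_{W_k};p_1,\dots,p_d)\bigr), $$ where $\varrho\colon W_1\to K$ is an injective one-dimensional character of $W_1$.
   Context: $K$ is an algebraically closed field of characteristic zero; $d,k\ge1$; $S_d$ is the symmetric group; a one-dimensional character of a group $W$ is a homomorphism $W\to K^*$; $1_W$ is the trivial character. The graphs have vertex set $\{1,\dots,d\}$, and the automorphism group of a graph is the group of vertex permutations preserving edge multiplicities. Superpositions of $\Gamma_1,\dots,\Gamma_k$ are the ways of placing the graphs on a common set of $d$ vertices, up to simultaneous relabelling of the vertices; that is, the equivalence classes of tuples $(a_1,\dots,a_k)\in S_d\times\cdots\times S_d$ (where $a_m$ represents the placed copy $a_m\Gamma_m$) under $(a_1,\dots,a_k)\sim(b_1,\dots,b_k)$ iff there are $\zeta\in S_d$ and $w_m\in W_m$ with $b_m=\zeta a_mw_m$ for all $m$. The automorphism group of the superposition represented by $(a_1,\dots,a_k)$ is $a_1W_1a_1^{-1}\cap\cdots\cap a_kW_ka_k^{-1}$ (well defined up to conjugation in $S_d$). For $W\le S_d$ and a one-dimensional character $\chi$ of $W$, $Z(\chi;p_1,\dots,p_d)=|W|^{-1}\sum_{\sigma\in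 W}\chi(\sigma)p_1^{c_1(\sigma)}\cdots p_d^{c_d(\sigma)}$, where $c_s(\sigma)$ is the number of cycles of length $s$ of $\sigma$ and $p_s=\sum_{i\ge0}x_i^s$ are the power sums in $x_0,x_1,\dots$. With $R^d$ the group of generalized characters of $S_d$, $\Lambda^d$ the group of homogeneous degree $d$ symmetric functions with integer coefficients in $x_0,x_1,\dots$, and $ch\colon R^d\to\Lambda^d$ the (bijective) characteristic map $ch(u)=\frac1{d!}\sum_{\sigma\in S_d}u(\sigma)p_1^{c_1(\sigma)}\cdots p_d^{c_d(\sigma)}$, one has $Z(\chi;p_1,\dots,p_d)=ch(\mathrm{ind}_W^{S_d}(\chi))$, and the internal product on $\Lambda^d$ is defined by $ch(u)\ast ch(v)=ch(uv)$. For a polynomial $A$ in $p_1,\dots,p_d$, $N(A)$ is the sum of its coefficients. *)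

theory Defs
  imports
    "HOL-Algebra.Sym_Groups"
    "HOL-Algebra.Elementary_Groups"
    "HOL-Combinatorics.Orbits"
    "HOL-Computational_Algebra.Polynomial"
    "HOL-Library.Poly_Mapping"
    "HOL-Library.Uprod"
    "Jordan_Normal_Form.Matrix"
begin

section \<open>Multigraphs and superpositions\<close>

text \<open>
  A graph on the vertices \<open>1, \<dots>, d\<close> is the multiset of its edges. An edge is an unordered pair of
  vertices; \<open>Upair x x\<close> is a loop at \<open>x\<close>.
\<close>

definition multigraph :: "nat \<Rightarrow> nat uprod multiset \<Rightarrow> bool" where
  "multigraph d \<Gamma> \<longleftrightarrow> (\<forall>e\<in>#\<Gamma>. set_uprod e \<subseteq> {1..d})"

definition aut_group :: "nat \<Rightarrow> nat uprod multiset \<Rightarrow> (nat \<Rightarrow> nat) set" where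
  "aut_group d \<Gamma> = {\<sigma> \<in> carrier (sym_group d). \<forall>e. count \<Gamma> (map_uprod \<sigma> e) = count \<Gamma> e}"

definition placements :: "nat \<Rightarrow> nat \<Rightarrow> (nat \<Rightarrow> nat \<Rightarrow> nat) set" where
  "placements d k = (\<Pi>\<^sub>E m\<in>{1..k}. carrier (sym_group d))"

definition superposition_rel ::
    "nat \<Rightarrow> nat \<Rightarrow> (nat \<Rightarrow> (nat \<Rightarrow> nat) set) \<Rightarrow> (nat \<Rightarrow> nat \<Rightarrow> nat) rel" where
  "superposition_rel d k W =
     {(a, b). a \<in> placements d k \<and> b \<in> placements d k \<and>
        (\<exists>\<zeta>\<in>carrier (sym_group d). \<exists>w. \<forall>m\<in>{1..k}. w m \<in> W m \<and> b m = \<zeta> \<circ> a m \<circ> w m)}"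

definition superpositions ::
    "nat \<Rightarrow> nat \<Rightarrow> (nat \<Rightarrow> (nat \<Rightarrow> nat) set) \<Rightarrow> (nat \<Rightarrow> nat \<Rightarrow> nat) set set" where
  "superpositions d k W = placements d k // superposition_rel d k W"

definition superposition_aut ::
    "nat \<Rightarrow> (nat \<Rightarrow> (nat \<Rightarrow> nat) set) \<Rightarrow> (nat \<Rightarrow> nat \<Rightarrow> nat) \<Rightarrow> (nat \<Rightarrow> nat) set" where
  "superposition_aut k W a = (\<Inter>m\<in>{1..k}. (\<lambda>w. a m \<circ> w \<circ> inv_into UNIV (a m)) ` W m)"

text \<open>
  The automorphism groups of two representatives of the same superposition are conjugate, so it
  does not matter whether triviality is required of one representative or of all of them.
\<close>

definition asymmetric_superpositions ::
    "nat \<Rightarrow> nat \<Rightarrow> (nat \<Rightarrow> (nat \<Rightarrow> nat) set) \<Rightarrow> (nat \<Rightarrow> nat \<Rightarrow> nat) set set" where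
  "asymmetric_superpositions d k W =
     {S \<in> superpositions d k W. \<forall>a\<in>S. superposition_aut k W a = {id}}"


section \<open>Formal power series in \<open>x\<^sub>0, x\<^sub>1, \<dots>\<close>\<close>

text \<open>
  Symmetric functions live in the ring of formal power series in countably many variables. A
  monomial is the finite multiset of the indices of its variables.
\<close>

typedef 'a mfps = "UNIV :: (nat multiset \<Rightarrow> 'a) set"
  morphisms mfps_coeff Abs_mfps by simp

setup_lifting type_definition_mfps

lemma mfps_eqI: "(\<And>M. mfps_coeff f M = mfps_coeff g M) \<Longrightarrow> f = g"
  by transfer auto

definition splits :: "nat multiset \<Rightarrow> (nat multiset \<times> nat multiset) set" where
  "splits M = {(A, B). A + B = M}"

lemma finite_splits [simp]: "finite (splits M)"
proof (induction M)
  case empty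
  have "splits {#} = {({#}, {#})}" by (auto simp: splits_def)
  then show ?case by simp
next
  case (add x M)
  have "splits (add_mset x M) \<subseteq>
    (\<lambda>(A, B). (add_mset x A, B)) ` splits M \<union> (\<lambda>(A, B). (A, add_mset x B)) ` splits M"
  proof (rule subsetI)
    fix p assume "p \<in> splits (add_mset x M)"
    then obtain A B where p: "p = (A, B)" "A + B = add_mset x M" by (auto simp: splits_def)
    then have "x \<in># A + B" by simp
    then consider "x \<in># A" | "x \<in># B" by auto
    then show "p \<in> (\<lambda>(A, B). (add_mset x A, B)) ` splits M \<union>
        (\<lambda>(A, B). (A, add_mset x B)) ` splits M"
    proof cases
      case 1
      then obtain A' where "A = add_mset x A'" by (metis multi_member_split)
      with p have "p = (add_mset x A', B)" "(A', B) \<in> splits M" by (auto simp: splits_def)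
      then show ?thesis by force
    next
      case 2
      then obtain B' where "B = add_mset x B'" by (metis multi_member_split)
      with p have "p = (A, add_mset x B')" "(A, B') \<in> splits M" by (auto simp: splits_def)
      then show ?thesis by force
    qed
  qed
  with add show ?case by (meson finite_UnI finite_imageI finite_subset)
qed

instantiation mfps :: (comm_ring_1) comm_ring_1
begin

lift_definition zero_mfps :: "'a mfps" is "\<lambda>_. 0" .
lift_definition one_mfps :: "'a mfps" is "\<lambda>M. if M = {#} then 1 else 0" .
lift_definition plus_mfps :: "'a mfps \<Rightarrow> 'a mfps \<Rightarrow> 'a mfps" is "\<lambda>f g M. f M + g M" .
lift_definition minus_mfps :: "'a mfps \<Rightarrow> 'a mfps \<Rightarrow> 'a mfps" is "\<lambda>f g M. f M - g M" .
lift_definition uminus_mfps :: "'a mfps \<Rightarrow> 'a mfps" is "\<lambda>f M. - f M" .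
lift_definition times_mfps :: "'a mfps \<Rightarrow> 'a mfps \<Rightarrow> 'a mfps" is
  "\<lambda>f g M. \<Sum>(A, B)\<in>splits M. f A * g B" .

instance
proof
  fix f g h :: "'a mfps"
  show "f + g + h = f + (g + h)" "f + g = g + f" "0 + f = f" "- f + f = 0" "f - g = f + - g"
    by (transfer; simp add: algebra_simps)+
  show "(0 :: 'a mfps) \<noteq> 1"
    by transfer (auto simp: fun_eq_iff)
  show "(f + g) * h = f * h + g * h"
    by transfer (simp add: algebra_simps sum.distrib case_prod_unfold)
  show "f * g = g * f"
  proof (transfer, rule ext)
    fix f g :: "nat multiset \<Rightarrow> 'a" and M
    show "(\<Sum>(A, B)\<in>splits M. f A * g B) = (\<Sum>(A, B)\<in>splits M. g A * f B)"
      by (rule sum.reindex_bij_witness[where i = prod.swap and j = prod.swap])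
        (auto simp: splits_def ac_simps)
  qed
  show "1 * f = f"
  proof (transfer, rule ext)
    fix f :: "nat multiset \<Rightarrow> 'a" and M
    have "(\<Sum>(A, B)\<in>splits M. (if A = {#} then 1 else 0) * f B) =
        (\<Sum>(A, B)\<in>{({#} :: nat multiset, M)}. (if A = {#} then 1 else 0) * f B)"
      by (rule sum.mono_neutral_right[OF finite_splits]) (auto simp: splits_def split: if_splits)
    then show "(\<Sum>(A, B)\<in>splits M. (if A = {#} then 1 else 0) * f B) = f M"
      by simp
  qed
  show "f * g * h = f * (g * h)"
  proof (transfer, rule ext)
    fix f g h :: "nat multiset \<Rightarrow> 'a" and M
    have "(\<Sum>(A, B)\<in>splits M. (\<Sum>(C, D)\<in>splits A. f C * g D) * h B) =
        (\<Sum>(p, q)\<in>Sigma (splits M) (\<lambda>p. splits (fst p)). f (fst q) * g (snd q) * h (snd p))"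
      by (subst sum.Sigma[symmetric]) (simp_all add: sum_distrib_right case_prod_unfold)
    also have "\<dots> =
        (\<Sum>(p, q)\<in>Sigma (splits M) (\<lambda>p. splits (snd p)). f (fst p) * (g (fst q) * h (snd q)))"
      by (rule sum.reindex_bij_witness
          [where i = "\<lambda>(p, q). ((fst p + fst q, snd q), (fst p, fst q))"
             and j = "\<lambda>(p, q). ((fst q, snd q + snd p), (snd q, snd p))"])
        (auto simp: splits_def ac_simps)
    also have "\<dots> = (\<Sum>(A, B)\<in>splits M. f A * (\<Sum>(C, D)\<in>splits B. g C * h D))"
      by (subst sum.Sigma[symmetric]) (simp_all add: sum_distrib_left case_prod_unfold)
    finally show "(\<Sum>(A, B)\<in>splits M. (\<Sum>(C, D)\<in>splits A. f C * g D) * h B) =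
      (\<Sum>(A, B)\<in>splits M. f A * (\<Sum>(C, D)\<in>splits B. g C * h D))" .
  qed
qed

end

lift_definition mfps_const :: "'a :: comm_ring_1 \<Rightarrow> 'a mfps" is
  "\<lambda>c M. if M = {#} then c else 0" .

text \<open>The power sum \<open>p\<^sub>s = \<Sum>i. x\<^sub>i ^ s\<close>, a legitimate formal sum for \<open>s \<ge> 1\<close> only.\<close>

lift_definition power_sum :: "nat \<Rightarrow> 'a :: comm_ring_1 mfps" is
  "\<lambda>s M. if \<exists>i. M = replicate_mset s i then 1 else 0" .


section \<open>Cycle indices, the characteristic map and the internal product\<close>

text \<open>Fixed points count as cycles of length 1.\<close>

definition cycle_count :: "nat \<Rightarrow> nat \<Rightarrow> (nat \<Rightarrow> nat) \<Rightarrow> nat" where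
  "cycle_count d s \<sigma> = card {C \<in> orbit \<sigma> ` {1..d}. card C = s}"

definition cycle_monomial :: "nat \<Rightarrow> (nat \<Rightarrow> nat) \<Rightarrow> 'a :: comm_ring_1 mfps" where
  "cycle_monomial d \<sigma> = (\<Prod>s=1..d. power_sum s ^ cycle_count d s \<sigma>)"

definition one_dim_character ::
    "nat \<Rightarrow> (nat \<Rightarrow> nat) set \<Rightarrow> ((nat \<Rightarrow> nat) \<Rightarrow> 'a :: field_char_0) \<Rightarrow> bool" where
  "one_dim_character d W \<chi> \<longleftrightarrow>
     \<chi> \<in> hom (sym_group d\<lparr>carrier := W\<rparr>) \<lparr>carrier = UNIV - {0}, mult = (*), one = 1\<rparr>"

definition cycle_index ::
    "nat \<Rightarrow> (nat \<Rightarrow> nat) set \<Rightarrow> ((nat \<Rightarrow> nat) \<Rightarrow> 'a) \<Rightarrow> 'a :: field_char_0 mfps" where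
  "cycle_index d W \<chi> =
     mfps_const (1 / of_nat (card W)) * (\<Sum>\<sigma>\<in>W. mfps_const (\<chi> \<sigma>) * cycle_monomial d \<sigma>)"

definition mat_trace :: "'a :: comm_monoid_add mat \<Rightarrow> 'a" where
  "mat_trace A = (\<Sum>i<dim_row A. A $$ (i, i))"

text \<open>
  Functions on the symmetric group are taken to be extensional, so that two of them are equal iff
  they agree on the group.
\<close>

definition sym_characters :: "nat \<Rightarrow> ((nat \<Rightarrow> nat) \<Rightarrow> 'a :: field_char_0) set" where
  "sym_characters d =
     {(\<lambda>\<sigma>\<in>carrier (sym_group d). mat_trace (T \<sigma>)) | T n.
        T \<in> hom (sym_group d) (units_of (ring_mat TYPE('a) n ()))}"

text \<open>
  The additive group generated by the characters. It consists of their differences, since the sum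
  of two characters is the character of the direct sum.
\<close>

definition generalized_characters :: "nat \<Rightarrow> ((nat \<Rightarrow> nat) \<Rightarrow> 'a :: field_char_0) set" where
  "generalized_characters d =
     {(\<lambda>\<sigma>\<in>carrier (sym_group d). u \<sigma> - v \<sigma>) | u v.
        u \<in> sym_characters d \<and> v \<in> sym_characters d}"

definition characteristic_map ::
    "nat \<Rightarrow> ((nat \<Rightarrow> nat) \<Rightarrow> 'a) \<Rightarrow> 'a :: field_char_0 mfps" where
  "characteristic_map d u =
     mfps_const (1 / fact d) * (\<Sum>\<sigma>\<in>carrier (sym_group d). mfps_const (u \<sigma>) * cycle_monomial d \<sigma>)"

text \<open>
  In characteristic zero the characteristic map is a bijection from the generalized characters onto
  the homogeneous symmetric functions of degree \<open>d\<close> with integer coefficients (embedded in the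
  field). The internal product is only meaningful for the latter arguments.
\<close>

definition internal_product :: "nat \<Rightarrow> 'a :: field_char_0 mfps \<Rightarrow> 'a mfps \<Rightarrow> 'a mfps" where
  "internal_product d f g =
     (let ch_inv = the_inv_into (generalized_characters d) (characteristic_map d)
      in characteristic_map d (\<lambda>\<sigma>\<in>carrier (sym_group d). ch_inv f \<sigma> * ch_inv g \<sigma>))"


section \<open>Sum of the coefficients of a polynomial in the power sums\<close>

text \<open>
  A polynomial in \<open>p\<^sub>1, \<dots>, p\<^sub>d\<close> is a finitely supported function on monomials, where again a
  monomial is the multiset of the indices of its variables.
\<close>

definition eval_power_sums :: "(nat multiset \<Rightarrow>\<^sub>0 'a) \<Rightarrow> 'a :: comm_ring_1 mfps" where
  "eval_power_sums A =
     (\<Sum>M\<in>Poly_Mapping.keys A. mfps_const (Poly_Mapping.lookup A M) * prod_mset (image_mset power_sum M))"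

text \<open>
  In characteristic zero the power sums are algebraically independent, so the polynomial is unique
  if it exists.
\<close>

definition power_sum_polynomial :: "nat \<Rightarrow> 'a :: comm_ring_1 mfps \<Rightarrow> nat multiset \<Rightarrow>\<^sub>0 'a" where
  "power_sum_polynomial d f =
     (THE A. (\<forall>M\<in>Poly_Mapping.keys A. set_mset M \<subseteq> {1..d}) \<and> eval_power_sums A = f)"

definition coeff_sum :: "(nat multiset \<Rightarrow>\<^sub>0 'a) \<Rightarrow> 'a :: comm_monoid_add" where
  "coeff_sum A = (\<Sum>M\<in>Poly_Mapping.keys A. Poly_Mapping.lookup A M)"

end

theory Submission
  imports Defs
begin

text \<open>
  \<open>Z(\<chi>)\<close> is the characteristic of the induced character, so the internal product is the
  characteristic of a product of induced characters, and applying \<open>N\<close> averages that product over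
  \<open>S\<^sub>d\<close>. Writing out the induced characters, this average is \<open>(d! \<Prod>\<^sub>m |W\<^sub>m|)\<^sup>-\<^sup>1\<close> times the sum,
  over all tuples \<open>a\<close>, of the sum of the values of a conjugate of \<open>\<rho>\<close> on the automorphism group of
  \<open>a\<close>. This character is injective, so the inner sum is 1 if the group is trivial and 0 otherwise.
  Finally \<open>S\<^sub>d \<times> \<Prod>\<^sub>m W\<^sub>m\<close> acts freely on the tuples with trivial automorphism group, and its orbits
  there are the asymmetric superpositions.
\<close>

section \<open>Algebraic independence of the power sums\<close>

text \<open>The obstacle is that \<open>internal_product\<close> and
  \<open>power_sum_polynomial\<close> are given implicitly, one through an inverse of the
  characteristic map, the other by a definite description, so nothing can be computed before
  uniqueness is known. For the polynomial this is algebraic independence of the power sums, proved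
  by triangularity against monomials. For the inverse it is injectivity of the characteristic map,
  which rests on two more facts: characters are class functions, and permutations of equal cycle
  type are conjugate. Moreover the inverse is guaranteed to return the expected function only for a
  generalized character, so every induced character and every partial product has to be exhibited as
  the trace of a matrix representation; induced matrices and tensor products serve for this. The
  denominators d! and \<Prod> |W m| of the average are together the size of a free orbit, which is
  why an average counts orbits.\<close>

lemma mfps_coeff_const_mult [simp]: "mfps_coeff (mfps_const c * f) M = c * mfps_coeff f M"
proof -
  have "(\<Sum>(A, B)\<in>splits M. (if A = {#} then c else 0) * mfps_coeff f B) =
      (\<Sum>(A, B)\<in>{({#} :: nat multiset, M)}. (if A = {#} then c else 0) * mfps_coeff f B)"
    by (rule sum.mono_neutral_right[OF finite_splits]) (auto simp: splits_def split: if_splits)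
  then show ?thesis
    by (simp add: times_mfps.rep_eq mfps_const.rep_eq)
qed

lemma mfps_coeff_sum [simp]: "mfps_coeff (sum f S) M = (\<Sum>x\<in>S. mfps_coeff (f x) M)"
  by (induction S rule: infinite_finite_induct) (simp_all add: zero_mfps.rep_eq plus_mfps.rep_eq)

lemma mfps_const_mult: "mfps_const (a * b) = mfps_const a * mfps_const b"
  by (rule mfps_eqI) (simp add: mfps_const.rep_eq)

lemma mfps_const_sum: "mfps_const (sum f S) = (\<Sum>x\<in>S. mfps_const (f x))"
  by (rule mfps_eqI) (simp add: mfps_const.rep_eq)

lemma mfps_const_add: "mfps_const (a + b) = mfps_const a + mfps_const b"
  by (rule mfps_eqI) (simp add: mfps_const.rep_eq plus_mfps.rep_eq)

lemma mfps_const_0: "mfps_const 0 = 0"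
  by (rule mfps_eqI) (simp add: mfps_const.rep_eq zero_mfps.rep_eq)

abbreviation power_sum_prod :: "nat multiset \<Rightarrow> 'a :: comm_ring_1 mfps" where
  "power_sum_prod L \<equiv> prod_mset (image_mset power_sum L)"

text \<open>The multiset of exponents of the monomial \<open>M\<close>, that is, the partition
  labelling the monomial symmetric function in which \<open>M\<close> occurs.\<close>

definition shape :: "'b multiset \<Rightarrow> nat multiset" where
  "shape M = image_mset (count M) (mset_set (set_mset M))"

lemma size_shape: "size (shape M) = card (set_mset M)"
  by (simp add: shape_def)

lemma shape_replicate_plus:
  assumes "s > 0" "i \<notin># B"
  shows "shape (replicate_mset s i + B) = add_mset s (shape B)"
proof -
  have set: "set_mset (replicate_mset s i + B) = insert i (set_mset B)"
    using assms by auto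
  have "image_mset (count (replicate_mset s i + B)) (mset_set (set_mset B)) =
      image_mset (count B) (mset_set (set_mset B))"
    using assms by (intro image_mset_cong) auto
  then show ?thesis
    using assms by (simp add: shape_def set not_in_iff)
qed

lemma exists_shape:
  assumes "0 \<notin># L"
  shows "\<exists>M :: nat multiset. shape M = L"
  using assms
proof (induction L)
  case empty
  have "shape {#} = {#}" by (simp add: shape_def)
  then show ?case by blast
next
  case (add s L)
  then obtain M :: "nat multiset" where M: "shape M = L" by auto
  obtain i where "i \<notin> set_mset M"
    using ex_new_if_finite[of "set_mset M"] by auto
  then have "shape (replicate_mset s i + M) = add_mset s L"
    using add.prems M by (subst shape_replicate_plus) auto
  then show ?case by blast
qed

lemma power_sum_mult_coeff_nonzeroD:
  assumes "mfps_coeff (power_sum s * f) M \<noteq> 0"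
  obtains i B where "M = replicate_mset s i + B" "mfps_coeff f B \<noteq> 0"
proof -
  have "(\<Sum>(A, B)\<in>splits M. mfps_coeff (power_sum s) A * mfps_coeff f B) \<noteq> 0"
    using assms by (simp add: times_mfps.rep_eq)
  then obtain A B where "(A, B) \<in> splits M" "mfps_coeff (power_sum s) A * mfps_coeff f B \<noteq> 0"
    by (auto elim!: sum.not_neutral_contains_not_neutral)
  then show ?thesis
    using that by (auto simp: splits_def power_sum.rep_eq split: if_splits)
qed

text \<open>Expanding the product means choosing one variable for each factor. The number of
  variables is maximal exactly when all choices differ, and then the exponents are the parts of
  \<open>L\<close>. This is the triangular half of the comparison with monomials.\<close>

lemma power_sum_prod_coeff_nonzeroD:
  assumes "mfps_coeff (power_sum_prod L :: 'a :: comm_ring_1 mfps) M \<noteq> 0" "0 \<notin># L"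
  shows "card (set_mset M) \<le> size L \<and> (card (set_mset M) = size L \<longrightarrow> shape M = L)"
  using assms
proof (induction L arbitrary: M)
  case empty
  then have "M = {#}" by (auto simp: one_mfps.rep_eq split: if_splits)
  then show ?case by (simp add: shape_def)
next
  case (add s L)
  then obtain i B where B: "M = replicate_mset s i + B" "mfps_coeff (power_sum_prod L :: 'a mfps) B \<noteq> 0"
    by (auto elim: power_sum_mult_coeff_nonzeroD)
  have IH: "card (set_mset B) \<le> size L" "card (set_mset B) = size L \<longrightarrow> shape B = L"
    using add.IH[OF B(2)] add.prems by auto
  have s: "s > 0" using add.prems by (cases s) auto
  have set: "set_mset M = insert i (set_mset B)"
    using B(1) s by auto
  show ?case
  proof (cases "i \<in># B")
    case True
    then show ?thesis using IH(1) set by (simp add: insert_absorb)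
  next
    case False
    then show ?thesis
      using IH set shape_replicate_plus[OF s False] B(1) by simp
  qed
qed

lemma sum_in_Nats: "(\<And>x. x \<in> S \<Longrightarrow> f x \<in> \<nat>) \<Longrightarrow> sum f S \<in> \<nat>"
  by (induction S rule: infinite_finite_induct) auto

text \<open>Natural number coefficients rule out cancellation in characteristic zero: one nonzero
  term of a convolution already makes the whole sum nonzero.\<close>

lemma power_sum_prod_coeff_Nats:
  "mfps_coeff (power_sum_prod L) M \<in> (\<nat> :: 'a :: comm_ring_1 set)"
proof (induction L arbitrary: M)
  case (add s L)
  then show ?case
    by (auto simp: times_mfps.rep_eq power_sum.rep_eq case_prod_unfold intro!: sum_in_Nats)
qed (auto simp: one_mfps.rep_eq)

lemma sum_Nats_nonzero:
  fixes f :: "'b \<Rightarrow> 'a :: ring_char_0"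
  assumes "finite S" "\<And>x. x \<in> S \<Longrightarrow> f x \<in> \<nat>" "x \<in> S" "f x \<noteq> 0"
  shows "sum f S \<noteq> 0"
proof -
  have "\<forall>y\<in>S. \<exists>n. f y = of_nat n" using assms(2) by (auto elim: Nats_cases)
  then obtain n where n: "\<forall>y\<in>S. f y = of_nat (n y)" by metis
  then have "sum f S = of_nat (\<Sum>y\<in>S. n y)" by simp
  moreover have "n x \<noteq> 0" using n assms by auto
  then have "(\<Sum>y\<in>S. n y) \<noteq> 0" using assms by auto
  ultimately show ?thesis by (metis of_nat_eq_0_iff)
qed

text \<open>The diagonal coefficient counts the ways to match the parts of \<open>L\<close> with the
  variables of \<open>M\<close> having these exponents. One matching is enough, and it is built by
  stripping off a variable whose exponent is the part \<open>s\<close>.\<close>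

lemma power_sum_prod_coeff_shape:
  assumes "shape M = L"
  shows "mfps_coeff (power_sum_prod L :: 'a :: {comm_ring_1, ring_char_0} mfps) M \<noteq> 0"
  using assms
proof (induction L arbitrary: M)
  case empty
  then have "M = {#}" by (auto simp: shape_def mset_set_empty_iff)
  then show ?case by (simp add: one_mfps.rep_eq)
next
  case (add s L)
  then have "s \<in># shape M" by simp
  then obtain i where i: "i \<in># M" "s = count M i" by (auto simp: shape_def)
  define B where "B = filter_mset (\<lambda>j. j \<noteq> i) M"
  have M: "M = replicate_mset s i + B"
    unfolding B_def i by (rule multiset_eqI) auto
  moreover have "s > 0" "i \<notin># B" using i by (auto simp: B_def)
  ultimately have "shape B = L"
    using add.prems shape_replicate_plus[of s i B] by simp
  then have nz: "mfps_coeff (power_sum_prod L :: 'a mfps) B \<noteq> 0" by (rule add.IH)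
  have "(\<Sum>p\<in>splits M. mfps_coeff (power_sum s) (fst p) *
      mfps_coeff (power_sum_prod L) (snd p)) \<noteq> (0 :: 'a)"
  proof (rule sum_Nats_nonzero[where x = "(replicate_mset s i, B)"])
    show "mfps_coeff (power_sum s) (fst p) * mfps_coeff (power_sum_prod L) (snd p) \<in> (\<nat> :: 'a set)"
      for p
      by (intro Nats_mult power_sum_prod_coeff_Nats) (auto simp: power_sum.rep_eq)
    show "finite (splits M)" by simp
    show "(replicate_mset s i, B) \<in> splits M" using M by (simp add: splits_def)
    have "mfps_coeff (power_sum s :: 'a mfps) (replicate_mset s i) = 1"
      unfolding power_sum.rep_eq by (rule if_P) blast
    then show "mfps_coeff (power_sum s) (fst (replicate_mset s i, B)) *
        mfps_coeff (power_sum_prod L) (snd (replicate_mset s i, B)) \<noteq> (0 :: 'a)"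
      using nz by simp
  qed
  then show ?case by (simp add: times_mfps.rep_eq case_prod_unfold)
qed

section \<open>Polynomials in the power sums and their uniqueness\<close>

lemma eval_power_sums_superset:
  assumes "finite S" "Poly_Mapping.keys A \<subseteq> S"
  shows "eval_power_sums A = (\<Sum>L\<in>S. mfps_const (Poly_Mapping.lookup A L) * power_sum_prod L)"
  unfolding eval_power_sums_def
  by (rule sum.mono_neutral_left) (use assms in \<open>auto simp: in_keys_iff mfps_const_0\<close>)

lemma eval_power_sums_add: "eval_power_sums (A + B) = eval_power_sums A + eval_power_sums B"
proof -
  let ?S = "Poly_Mapping.keys A \<union> Poly_Mapping.keys B"
  have "Poly_Mapping.keys (A + B) \<subseteq> ?S" by (rule keys_add)
  then show ?thesis
    by (simp add: eval_power_sums_superset[of ?S] lookup_add mfps_const_add ring_distribs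
        sum.distrib)
qed

text \<open>
  Among the monomials of a vanishing polynomial pick one with the largest number of factors; the
  coefficient at any \<open>M\<close> whose shape is that monomial receives no other contribution.
\<close>

lemma eval_power_sums_eq_0:
  fixes A :: "nat multiset \<Rightarrow>\<^sub>0 'a :: {idom, ring_char_0}"
  assumes "eval_power_sums A = 0" "\<And>L. L \<in> Poly_Mapping.keys A \<Longrightarrow> 0 \<notin># L"
  shows "A = 0"
proof (rule ccontr)
  assume "A \<noteq> 0"
  then have "Poly_Mapping.keys A \<noteq> {}" by simp
  then have "Max (size ` Poly_Mapping.keys A) \<in> size ` Poly_Mapping.keys A"
    by (intro Max_in) auto
  then obtain L where L: "L \<in> Poly_Mapping.keys A" "size L = Max (size ` Poly_Mapping.keys A)"
    by auto
  have max: "size L' \<le> size L" if "L' \<in> Poly_Mapping.keys A" for L'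
    unfolding L(2) using that by (intro Max_ge) auto
  obtain M :: "nat multiset" where M: "shape M = L"
    using exists_shape[OF assms(2)[OF L(1)]] ..
  let ?c = "\<lambda>L'. Poly_Mapping.lookup A L' * mfps_coeff (power_sum_prod L') M"
  have "?c L' = 0" if "L' \<in> Poly_Mapping.keys A" "L' \<noteq> L" for L'
  proof -
    have "card (set_mset M) = size L"
      using size_shape[of M] M by simp
    then have "mfps_coeff (power_sum_prod L') M = (0 :: 'a)"
      using power_sum_prod_coeff_nonzeroD[of L' M, where 'a = 'a] assms(2)[OF that(1)]
        max[OF that(1)] M that(2)
      by (metis order_antisym)
    then show ?thesis by simp
  qed
  then have "(\<Sum>L'\<in>Poly_Mapping.keys A. ?c L') = ?c L"
    by (subst sum.remove[OF finite_keys L(1)]) (simp add: sum.neutral)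
  then have "?c L = 0"
    using arg_cong[OF assms(1), of "\<lambda>f. mfps_coeff f M"]
    by (simp add: eval_power_sums_def zero_mfps.rep_eq)
  then show False
    using L(1) power_sum_prod_coeff_shape[OF M, where 'a = 'a] by (simp add: in_keys_iff)
qed

lemma power_sum_polynomial_eval:
  fixes A :: "nat multiset \<Rightarrow>\<^sub>0 'a :: {idom, ring_char_0}"
  assumes "\<And>L. L \<in> Poly_Mapping.keys A \<Longrightarrow> set_mset L \<subseteq> {1..d}"
  shows "power_sum_polynomial d (eval_power_sums A) = A"
  unfolding power_sum_polynomial_def
proof (rule the_equality)
  show "(\<forall>M\<in>Poly_Mapping.keys A. set_mset M \<subseteq> {1..d}) \<and> eval_power_sums A = eval_power_sums A"
    using assms by blast
next
  fix B :: "nat multiset \<Rightarrow>\<^sub>0 'a"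
  assume B: "(\<forall>M\<in>Poly_Mapping.keys B. set_mset M \<subseteq> {1..d}) \<and>
    eval_power_sums B = eval_power_sums A"
  have "eval_power_sums (B - A) + eval_power_sums A = eval_power_sums A"
    using B eval_power_sums_add[of "B - A" A] by simp
  moreover have "0 \<notin># L" if "L \<in> Poly_Mapping.keys (B - A)" for L
  proof -
    have "L \<in> Poly_Mapping.keys B \<or> L \<in> Poly_Mapping.keys A"
      using that keys_diff[of B A] by auto
    then have "set_mset L \<subseteq> {1..d}"
      using B assms by blast
    then show ?thesis by auto
  qed
  ultimately have "B - A = 0"
    by (intro eval_power_sums_eq_0) auto
  then show "B = A" by simp
qed

lemma coeff_sum_superset:
  assumes "finite S" "Poly_Mapping.keys A \<subseteq> S"
  shows "coeff_sum A = (\<Sum>L\<in>S. Poly_Mapping.lookup A L)"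
  unfolding coeff_sum_def
  by (rule sum.mono_neutral_left) (use assms in \<open>auto simp: in_keys_iff\<close>)


section \<open>Cycle types and conjugacy\<close>

text \<open>On the cycle of \<open>x\<close> the iterates of \<open>f\<close> behave like the
  integers modulo its length. Coincidences among iterates therefore depend on the length alone,
  which allows cycles of two different permutations to be compared.\<close>

lemma funpow_eq_iff_mod_card_orbit:
  assumes "permutation f"
  shows "(f ^^ i) x = (f ^^ j) x \<longleftrightarrow> i mod card (orbit f x) = j mod card (orbit f x)"
proof -
  define c where "c = funpow_dist1 f x x"
  have x: "x \<in> orbit f x"
    using assms by (rule permutation_self_in_orbit)
  have inj: "inj_on (\<lambda>n. (f ^^ n) x) {0..<c}"
    unfolding c_def by (rule inj_on_funpow_dist1[OF x])
  then have card: "card (orbit f x) = c"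
    using orbit_conv_funpow_dist1[OF x] by (simp add: card_image c_def[symmetric])
  have "(f ^^ c) x = x"
    unfolding c_def by (rule funpow_dist1_prop[OF x])
  then have mod: "(f ^^ n) x = (f ^^ (n mod c)) x" for n
    by (rule funpow_mod_eq[symmetric])
  have "c > 0" by (simp add: c_def)
  then have "(f ^^ (i mod c)) x = (f ^^ (j mod c)) x \<longleftrightarrow> i mod c = j mod c"
    by (intro inj_on_eq_iff[OF inj]) auto
  then show ?thesis
    using mod[of i] mod[of j] card by simp
qed

text \<open>Bijections between corresponding fibres are glued together. With cardinality as both
  \<open>f\<close> and \<open>g\<close>, this matches the cycles of two permutations by
  length.\<close>

lemma ex_bij_betw_same_fibre_cards:
  assumes "finite A" "finite B"
    and "\<And>s. card {x \<in> A. f x = s} = card {y \<in> B. g y = s}"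
  shows "\<exists>h. bij_betw h A B \<and> (\<forall>x\<in>A. g (h x) = f x)"
proof -
  have "\<exists>h. bij_betw h {x \<in> A. f x = s} {y \<in> B. g y = s}" for s
    using assms by (intro finite_same_card_bij) auto
  then obtain h where h: "\<And>s. bij_betw (h s) {x \<in> A. f x = s} {y \<in> B. g y = s}"
    by metis
  define k where "k x = h (f x) x" for x
  have k: "k x \<in> B" "g (k x) = f x" if "x \<in> A" for x
    using bij_betwE[OF h[of "f x"]] that by (auto simp: k_def)
  moreover have "inj_on k A"
  proof (rule inj_onI)
    fix x y assume xy: "x \<in> A" "y \<in> A" "k x = k y"
    then have "f x = f y" using k by metis
    then show "x = y"
      using xy bij_betw_imp_inj_on[OF h[of "f x"]] by (auto simp: k_def inj_on_def)
  qed
  moreover have "B \<subseteq> k ` A"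
  proof
    fix y assume "y \<in> B"
    then have "y \<in> h (g y) ` {x \<in> A. f x = g y}"
      using bij_betw_imp_surj_on[OF h[of "g y"]] by simp
    then show "y \<in> k ` A" by (force simp: k_def)
  qed
  ultimately show ?thesis
    by (intro exI[of _ k]) (auto simp: bij_betw_def)
qed

text \<open>
  Fix a base point in every cycle of \<open>\<tau>\<close> and in the cycle of \<open>\<sigma>\<close> matched with it; the
  conjugating permutation sends \<open>\<tau>\<^sup>n b\<close> to \<open>\<sigma>\<^sup>n b'\<close>.
\<close>

lemma conjugate_if_orbits_match:
  assumes "finite S" "\<sigma> permutes S" "\<tau> permutes S"
    and h: "bij_betw h (orbit \<tau> ` S) (orbit \<sigma> ` S)"
    and card_h: "\<And>C. C \<in> orbit \<tau> ` S \<Longrightarrow> card (h C) = card C"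
  obtains a where "a permutes S" "a \<circ> \<tau> = \<sigma> \<circ> a"
proof -
  have perm: "permutation \<sigma>" "permutation \<tau>"
    using assms by (auto simp: permutation_permutes)
  define b where "b C = (SOME x. x \<in> C)" for C :: "'a set"
  have bC: "b C \<in> S \<and> orbit \<tau> (b C) = C" if "C \<in> orbit \<tau> ` S" for C
  proof -
    have "C \<noteq> {}" using that by (auto simp: orbit_nonempty)
    then have "b C \<in> C" by (simp add: b_def some_in_eq)
    then show ?thesis
      using that orbit_cyclic_eq3[OF cyclic_on_orbit'[OF perm(2)]]
        permutes_orbit_subset[OF assms(3)] by (auto simp: subset_iff)
  qed
  have bh: "b (h C) \<in> S \<and> orbit \<sigma> (b (h C)) = h C" if "C \<in> orbit \<tau> ` S" for C
  proof -
    have hC: "h C \<in> orbit \<sigma> ` S" using that h by (auto simp: bij_betw_def)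
    then have "h C \<noteq> {}" by (metis imageE orbit_nonempty)
    then have "b (h C) \<in> h C" by (simp add: b_def some_in_eq)
    then show ?thesis
      using hC orbit_cyclic_eq3[OF cyclic_on_orbit'[OF perm(1)]]
        permutes_orbit_subset[OF assms(2)] by (auto simp: subset_iff)
  qed
  define n where "n y = (SOME n. (\<tau> ^^ n) (b (orbit \<tau> y)) = y)" for y
  define a where "a y = (if y \<in> S then (\<sigma> ^^ n y) (b (h (orbit \<tau> y))) else y)" for y
  have n: "(\<tau> ^^ n y) (b (orbit \<tau> y)) = y" if "y \<in> S" for y
  proof -
    have "y \<in> orbit \<tau> (b (orbit \<tau> y))"
      using bC[of "orbit \<tau> y"] that permutation_self_in_orbit[OF perm(2)] by auto
    then have "\<exists>m. (\<tau> ^^ m) (b (orbit \<tau> y)) = y"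
      using funpow_dist_prop by fast
    then show ?thesis unfolding n_def by (rule someI_ex)
  qed
  \<comment> \<open>Matched cycles have equal length, so exponents agree on one side iff they agree
    on the other. One direction makes \<open>a\<close> commute with the permutations, the other
    makes it injective.\<close>
  have same_step: "(\<tau> ^^ i) (b C) = (\<tau> ^^ j) (b C) \<longleftrightarrow> (\<sigma> ^^ i) (b (h C)) = (\<sigma> ^^ j) (b (h C))"
    if "C \<in> orbit \<tau> ` S" for C i j
    using that bC bh card_h by (simp add: funpow_eq_iff_mod_card_orbit perm)
  have orbit_step: "orbit \<tau> (\<tau> y) = orbit \<tau> y" for y
    by (rule permutation_orbit_step[OF perm(2)])
  have commute: "a (\<tau> y) = \<sigma> (a y)" for y
  proof (cases "y \<in> S")
    case True
    let ?C = "orbit \<tau> y"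
    have C: "?C \<in> orbit \<tau> ` S" using True by simp
    have Ty: "\<tau> y \<in> S" using True assms(3) by (simp add: permutes_in_image)
    \<comment> \<open>The chosen exponents \<open>n (\<tau> y)\<close> and \<open>Suc (n y)\<close>
      may differ as numbers; they only lead to the same point of the cycle.\<close>
    have "(\<tau> ^^ n (\<tau> y)) (b ?C) = (\<tau> ^^ Suc (n y)) (b ?C)"
      using n[OF Ty] n[OF True] by (simp add: orbit_step)
    then have "(\<sigma> ^^ n (\<tau> y)) (b (h ?C)) = (\<sigma> ^^ Suc (n y)) (b (h ?C))"
      using same_step[OF C] by blast
    then show ?thesis using True Ty by (simp add: a_def orbit_step)
  next
    case False
    then show ?thesis using assms(2,3) by (simp add: a_def permutes_not_in)
  qed
  have a_orbit: "a y \<in> S \<and> orbit \<sigma> (a y) = h (orbit \<tau> y)" if "y \<in> S" for y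
  proof -
    have "orbit \<sigma> (b (h (orbit \<tau> y))) = h (orbit \<tau> y)" "b (h (orbit \<tau> y)) \<in> S"
      using bh that by auto
    moreover have "a y \<in> orbit \<sigma> (b (h (orbit \<tau> y)))"
      using that by (simp add: a_def orbit_altdef_permutation[OF perm(1)]) blast
    ultimately show ?thesis
      using permutes_orbit_subset[OF assms(2)] orbit_cyclic_eq3[OF cyclic_on_orbit'[OF perm(1)]]
      by blast
  qed
  have "inj_on a S"
  proof (rule inj_onI)
    fix y z assume yz: "y \<in> S" "z \<in> S" "a y = a z"
    then have "h (orbit \<tau> y) = h (orbit \<tau> z)" using a_orbit by metis
    then have eq: "orbit \<tau> y = orbit \<tau> z"
      using h yz by (auto simp: bij_betw_def inj_on_def)
    have "(\<tau> ^^ n y) (b (orbit \<tau> y)) = (\<tau> ^^ n z) (b (orbit \<tau> y))"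
      using yz eq by (subst same_step) (auto simp: a_def)
    then show "y = z" using n yz eq by metis
  qed
  moreover have "a ` S \<subseteq> S" using a_orbit by auto
  ultimately have "bij_betw a S S"
    using assms(1) by (simp add: bij_betw_def endo_inj_surj)
  then have "a permutes S"
    by (rule bij_imp_permutes) (simp add: a_def)
  then show ?thesis
    using commute by (intro that[of a]) (auto simp: fun_eq_iff)
qed

section \<open>The cycle type as a complete conjugacy invariant\<close>

lemma finite_carrier_sym_group [simp]: "finite (carrier (sym_group d))"
  by (simp add: sym_group_def finite_permutations)

lemma card_carrier_sym_group: "card (carrier (sym_group d)) = fact d"
  by (simp add: sym_group_def card_permutations)

text \<open>The image under \<open>a\<close> of each cycle of \<tau> is a cycle of \<sigma> of the
  same length, and every cycle of \<sigma> arises in this way.\<close>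

lemma cycle_count_conjugate:
  assumes "a permutes {1..d}" "\<tau> permutes {1..d}" "a \<circ> \<tau> = \<sigma> \<circ> a"
  shows "cycle_count d s \<sigma> = cycle_count d s \<tau>"
proof -
  have inj: "inj a" using assms(1) by (rule permutes_inj)
  have "permutation \<tau>" using assms(2) by (auto simp: permutation_permutes)
  then have orb: "orbit \<sigma> (a x) = a ` orbit \<tau> x" for x
    using assms(3) permutation_self_in_orbit
    by (intro orbit_inverse[symmetric]) (auto simp: fun_eq_iff)
  have "orbit \<sigma> ` {1..d} = orbit \<sigma> ` a ` {1..d}"
    using assms(1) by (simp add: permutes_image)
  also have "\<dots> = (`) a ` (orbit \<tau> ` {1..d})"
    by (simp add: image_image orb)
  finally have "{C \<in> orbit \<sigma> ` {1..d}. card C = s} = (`) a ` {C \<in> orbit \<tau> ` {1..d}. card C = s}"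
    using inj by (auto simp: card_image inj_on_subset)
  moreover have "inj ((`) a)" using inj by (simp add: inj_image_eq_iff inj_def)
  ultimately show ?thesis
    by (simp add: cycle_count_def card_image inj_on_subset)
qed

lemma cycle_count_eq_imp_conjugate:
  assumes "\<sigma> permutes {1..d}" "\<tau> permutes {1..d}"
    and "\<And>s. s \<in> {1..d} \<Longrightarrow> cycle_count d s \<sigma> = cycle_count d s \<tau>"
  obtains a where "a permutes {1..d}" "a \<circ> \<tau> = \<sigma> \<circ> a"
proof -
  have range: "card C \<in> {1..d}" if "C \<in> orbit \<pi> ` {1..d}" "\<pi> permutes {1..d}" for C \<pi>
  proof -
    have "C \<subseteq> {1..d}" "C \<noteq> {}"
      using that permutes_orbit_subset orbit_nonempty by fastforce+
    then show ?thesis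
      using card_mono[of "{1..d}" C] by (auto simp: Suc_le_eq card_gt_0_iff finite_subset)
  qed
  \<comment> \<open>The hypothesis covers lengths from 1 to \<open>d\<close> only; for any other
    length both sets of cycles are empty.\<close>
  have "card {C \<in> orbit \<tau> ` {1..d}. card C = s} = card {C \<in> orbit \<sigma> ` {1..d}. card C = s}" for s
  proof (cases "s \<in> {1..d}")
    case True
    then show ?thesis using assms(3) by (simp add: cycle_count_def)
  next
    case False
    then have "{C \<in> orbit \<tau> ` {1..d}. card C = s} = {}" "{C \<in> orbit \<sigma> ` {1..d}. card C = s} = {}"
      using range assms by blast+
    then show ?thesis by (simp only:)
  qed
  then obtain h where h: "bij_betw h (orbit \<tau> ` {1..d}) (orbit \<sigma> ` {1..d})"
    "\<forall>C\<in>orbit \<tau> ` {1..d}. card (h C) = card C"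
    using ex_bij_betw_same_fibre_cards[of "orbit \<tau> ` {1..d}" "orbit \<sigma> ` {1..d}" card card] by auto
  show ?thesis
    by (rule conjugate_if_orbits_match[OF _ assms(1,2) h(1)]) (use h(2) that in auto)
qed

text \<open>Cycle lengths are stored in the format used for monomials in the power sums, so the
  cycle type of a permutation is literally the index of its monomial.\<close>

definition cycle_type :: "nat \<Rightarrow> (nat \<Rightarrow> nat) \<Rightarrow> nat multiset" where
  "cycle_type d \<sigma> = (\<Sum>s=1..d. replicate_mset (cycle_count d s \<sigma>) s)"

lemma set_cycle_type: "set_mset (cycle_type d \<sigma>) \<subseteq> {1..d}"
  by (auto simp: cycle_type_def set_mset_sum split: if_splits)

lemma count_cycle_type:
  assumes "s \<in> {1..d}"
  shows "count (cycle_type d \<sigma>) s = cycle_count d s \<sigma>"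
proof -
  have "count (cycle_type d \<sigma>) s = (\<Sum>t=1..d. if t = s then cycle_count d t \<sigma> else 0)"
    unfolding cycle_type_def count_sum by (intro sum.cong) auto
  then show ?thesis using assms by simp
qed

lemma cycle_monomial_eq_power_sum_prod:
  "(cycle_monomial d \<sigma> :: 'a :: comm_ring_1 mfps) = power_sum_prod (cycle_type d \<sigma>)"
proof -
  have "power_sum_prod (\<Sum>s\<in>S. replicate_mset (c s) s) = (\<Prod>s\<in>S. power_sum s ^ c s :: 'a mfps)"
    if "finite S" for S and c :: "nat \<Rightarrow> nat"
    using that by (induction S rule: finite_induct) simp_all
  then show ?thesis by (simp add: cycle_monomial_def cycle_type_def)
qed

lemma cycle_type_eq_imp_conjugate:
  assumes "\<sigma> permutes {1..d}" "\<tau> permutes {1..d}" "cycle_type d \<sigma> = cycle_type d \<tau>"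
  obtains a where "a permutes {1..d}" "a \<circ> \<tau> = \<sigma> \<circ> a"
  using cycle_count_eq_imp_conjugate[OF assms(1,2)] count_cycle_type assms(3) by metis


section \<open>Matrix representations and induction\<close>

text \<open>Rows and columns may be indexed by any finite set: a coset transversal for induced
  representations, pairs for tensor products. Numbering the indices is postponed to the passage to
  actual matrices.\<close>

definition matrix_rep ::
    "('g, 'b) monoid_scheme \<Rightarrow> 'i set \<Rightarrow> ('g \<Rightarrow> 'i \<Rightarrow> 'i \<Rightarrow> 'a :: comm_ring_1) \<Rightarrow> bool" where
  "matrix_rep G I A \<longleftrightarrow> finite I \<and>
     (\<forall>i\<in>I. \<forall>j\<in>I. A \<one>\<^bsub>G\<^esub> i j = (if i = j then 1 else 0)) \<and>
     (\<forall>x\<in>carrier G. \<forall>y\<in>carrier G. \<forall>i\<in>I. \<forall>j\<in>I. A (x \<otimes>\<^bsub>G\<^esub> y) i j = (\<Sum>l\<in>I. A x i l * A y l j))"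

lemma matrix_rep_tensor:
  assumes "matrix_rep G I A" "matrix_rep G J B"
  shows "matrix_rep G (I \<times> J) (\<lambda>x p q. A x (fst p) (fst q) * B x (snd p) (snd q))"
  using assms unfolding matrix_rep_def
  by (auto simp: sum_product sum.cartesian_product intro!: sum.cong)

text \<open>The usual trace(XY) = trace(YX), obtained by exchanging the two summations. It is the
  source of the class function property.\<close>

lemma matrix_rep_trace_commute:
  assumes "matrix_rep G I A" "x \<in> carrier G" "y \<in> carrier G"
  shows "(\<Sum>i\<in>I. A (x \<otimes>\<^bsub>G\<^esub> y) i i) = (\<Sum>i\<in>I. A (y \<otimes>\<^bsub>G\<^esub> x) i i)"
proof -
  have "(\<Sum>i\<in>I. A (x \<otimes>\<^bsub>G\<^esub> y) i i) = (\<Sum>i\<in>I. \<Sum>l\<in>I. A x i l * A y l i)"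
    using assms by (intro sum.cong) (auto simp: matrix_rep_def)
  also have "\<dots> = (\<Sum>l\<in>I. \<Sum>i\<in>I. A y l i * A x i l)"
    by (subst sum.swap) (simp add: mult.commute)
  also have "\<dots> = (\<Sum>i\<in>I. A (y \<otimes>\<^bsub>G\<^esub> x) i i)"
    using assms by (intro sum.cong) (auto simp: matrix_rep_def)
  finally show ?thesis .
qed

section \<open>Coset representatives and induced characters\<close>

context group
begin

text \<open>Once \<open>m_assoc\<close> has nested products to the right, a cancelling pair is no
  longer a subterm that \<open>r_inv\<close> matches; this rule and the next one cancel it
  there.\<close>

lemma mult_inv_mult: "a \<in> carrier G \<Longrightarrow> b \<in> carrier G \<Longrightarrow> a \<otimes> (inv a \<otimes> b) = b"
  by (simp add: m_assoc[symmetric])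

lemma inv_mult_mult: "a \<in> carrier G \<Longrightarrow> b \<in> carrier G \<Longrightarrow> inv a \<otimes> (a \<otimes> b) = b"
  by (simp add: m_assoc[symmetric])

lemma ex_left_transversal:
  assumes "subgroup W G"
  obtains I where "I \<subseteq> carrier G" "\<And>g. g \<in> carrier G \<Longrightarrow> \<exists>!r. r \<in> I \<and> inv r \<otimes> g \<in> W"
proof -
  interpret W: subgroup W G by fact
  define P where "P a b \<longleftrightarrow> b \<in> carrier G \<and> inv a \<otimes> b \<in> W" for a b
  have sym: "inv b \<otimes> a \<in> W" if "a \<in> carrier G" "P a b" for a b
  proof -
    have "inv (inv a \<otimes> b) \<in> W" using that by (simp add: P_def)
    then show ?thesis using that by (simp add: P_def inv_mult_group)
  qed
  have trans: "P a c" if "a \<in> carrier G" "b \<in> carrier G" "c \<in> carrier G" "P a b" "P b c" for a b c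
  proof -
    have "(inv a \<otimes> b) \<otimes> (inv b \<otimes> c) \<in> W" using that by (auto simp: P_def)
    then show ?thesis using that by (simp add: P_def m_assoc mult_inv_mult)
  qed
  define r where "r a = (SOME b. P a b)" for a
  have r: "P a (r a)" if "a \<in> carrier G" for a
    unfolding r_def by (rule someI[of _ a]) (use that in \<open>simp add: P_def\<close>)
  show ?thesis
  proof (rule that[of "r ` carrier G"])
    show "r ` carrier G \<subseteq> carrier G" using r by (auto simp: P_def)
    fix g assume g: "g \<in> carrier G"
    show "\<exists>!b. b \<in> r ` carrier G \<and> inv b \<otimes> g \<in> W"
    proof (rule ex1I[of _ "r g"])
      show "r g \<in> r ` carrier G \<and> inv (r g) \<otimes> g \<in> W"
        using g r sym by auto
    next
      fix b assume b: "b \<in> r ` carrier G \<and> inv b \<otimes> g \<in> W"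
      then obtain a where a: "a \<in> carrier G" "b = r a" by auto
      have ra: "r a \<in> carrier G" using r[OF a(1)] by (simp add: P_def)
      have ag: "P a g"
        using trans[OF a(1) ra g r[OF a(1)]] b a g by (simp add: P_def)
      then have ga: "P g a" using sym[OF a(1)] a g by (simp add: P_def)
      \<comment> \<open>The representative is chosen from the predicate \<open>P a\<close>, which
        depends on the coset of \<open>a\<close> only; equal predicates force equal choices.\<close>
      have "P a = P g"
      proof
        fix c show "P a c = P g c"
          using trans[OF a(1) g _ ag, of c] trans[OF g a(1) _ ga, of c] by (auto simp: P_def)
      qed
      then show "b = r g" by (simp add: a r_def)
    qed
  qed
qed

definition extend_by_0 :: "'a set \<Rightarrow> ('a \<Rightarrow> 'k) \<Rightarrow> 'a \<Rightarrow> 'k :: field_char_0" where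
  "extend_by_0 W \<chi> g = (if g \<in> W then \<chi> g else 0)"

text \<open>Frobenius's formula, averaged over the whole group instead of summed over coset
  representatives. It involves no choice, and a product of such sums expands into a sum over all
  tuples of group elements.\<close>

definition induced :: "'a set \<Rightarrow> ('a \<Rightarrow> 'k) \<Rightarrow> 'a \<Rightarrow> 'k :: field_char_0" where
  "induced W \<chi> \<sigma> = 1 / of_nat (card W) * (\<Sum>a\<in>carrier G. extend_by_0 W \<chi> (inv a \<otimes> \<sigma> \<otimes> a))"

lemma
  assumes "subgroup W G" "\<And>v w. v \<in> W \<Longrightarrow> w \<in> W \<Longrightarrow> \<chi> (v \<otimes> w) = \<chi> v * \<chi> w"
    and "w \<in> W" "g \<in> carrier G"
  shows extend_by_0_mult_right: "extend_by_0 W \<chi> (g \<otimes> w) = extend_by_0 W \<chi> g * \<chi> w"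
    and extend_by_0_mult_left: "extend_by_0 W \<chi> (w \<otimes> g) = \<chi> w * extend_by_0 W \<chi> g"
proof -
  interpret W: subgroup W G by fact
  have "g \<in> W" if "g \<otimes> w \<in> W"
  proof -
    have "(g \<otimes> w) \<otimes> inv w \<in> W" using that assms by blast
    then show ?thesis using assms by (simp add: m_assoc)
  qed
  then show "extend_by_0 W \<chi> (g \<otimes> w) = extend_by_0 W \<chi> g * \<chi> w"
    using assms by (auto simp: extend_by_0_def)
  have "g \<in> W" if "w \<otimes> g \<in> W"
  proof -
    have "inv w \<otimes> (w \<otimes> g) \<in> W" using that assms by blast
    then show ?thesis using assms by (simp add: m_assoc[symmetric])
  qed
  then show "extend_by_0 W \<chi> (w \<otimes> g) = \<chi> w * extend_by_0 W \<chi> g"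
    using assms by (auto simp: extend_by_0_def)
qed

text \<open>The values \<chi> of \<open>w\<close> and of its inverse come out on the two sides, and
  since they are scalars they cancel.\<close>

lemma extend_by_0_conjugate:
  assumes "subgroup W G" "\<And>v w. v \<in> W \<Longrightarrow> w \<in> W \<Longrightarrow> \<chi> (v \<otimes> w) = \<chi> v * \<chi> w" "\<chi> \<one> = 1"
    and "w \<in> W" "g \<in> carrier G"
  shows "extend_by_0 W \<chi> (inv w \<otimes> g \<otimes> w) = extend_by_0 W \<chi> g"
proof -
  interpret W: subgroup W G by fact
  have iw: "inv w \<in> W" using assms(4) by simp
  have "extend_by_0 W \<chi> (inv w \<otimes> g \<otimes> w) = \<chi> (inv w) * extend_by_0 W \<chi> g * \<chi> w"
    using assms iw by (simp add: extend_by_0_mult_right extend_by_0_mult_left)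
  also have "\<dots> = \<chi> (inv w \<otimes> w) * extend_by_0 W \<chi> g"
    using assms(2)[OF iw assms(4)] by simp
  finally show ?thesis using assms by simp
qed

text \<open>
  The matrix of the induced representation with respect to a left transversal \<open>I\<close> has the entry
  \<open>\<chi>(i\<^sup>-\<^sup>1 \<sigma> j)\<close>, read as \<open>0\<close> outside \<open>W\<close>, at \<open>(i, j)\<close>.
\<close>

lemma induced_eq_matrix_trace:
  assumes "finite (carrier G)" "subgroup W G"
    and \<chi>: "\<And>v w. v \<in> W \<Longrightarrow> w \<in> W \<Longrightarrow> \<chi> (v \<otimes> w) = \<chi> v * \<chi> w" "\<chi> \<one> = 1"
  obtains I A where "matrix_rep G (I :: 'a set) A"
    "\<And>\<sigma>. \<sigma> \<in> carrier G \<Longrightarrow> induced W \<chi> \<sigma> = (\<Sum>i\<in>I. A \<sigma> i i)"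
proof -
  interpret W: subgroup W G by fact
  let ?\<chi> = "extend_by_0 W \<chi>"
  obtain I where I: "I \<subseteq> carrier G" "\<And>g. g \<in> carrier G \<Longrightarrow> \<exists>!r. r \<in> I \<and> inv r \<otimes> g \<in> W"
    using ex_left_transversal[OF assms(2)] by blast
  have finI: "finite I" using I(1) assms(1) by (rule finite_subset)
  have unique: "i = j" if "i \<in> I" "j \<in> I" "inv i \<otimes> j \<in> W" for i j
    using I(2)[of j] that I(1) by (metis W.one_closed l_inv subsetD)
  define A where "A \<sigma> i j = ?\<chi> (inv i \<otimes> \<sigma> \<otimes> j)" for \<sigma> i j
  have "matrix_rep G I A"
    unfolding matrix_rep_def
  proof (intro conjI ballI)
    show "finite I" by fact
  next
    fix i j assume ij: "i \<in> I" "j \<in> I"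
    show "A \<one> i j = (if i = j then 1 else 0)"
    proof (cases "i = j")
      case True
      then show ?thesis using ij I(1) \<chi>(2) by (auto simp: A_def extend_by_0_def subset_iff)
    next
      case False
      then have "inv i \<otimes> j \<notin> W" using unique ij by blast
      then show ?thesis using ij I(1) False by (auto simp: A_def extend_by_0_def subset_iff)
    qed
  next
    fix x y i j assume xy: "x \<in> carrier G" "y \<in> carrier G" and ij: "i \<in> I" "j \<in> I"
    have c: "i \<in> carrier G" "j \<in> carrier G" using ij I(1) by auto
    \<comment> \<open>In column \<open>j\<close> of the matrix of \<open>y\<close> only the row of
      the representative \<open>r\<close> of the coset of \<open>y \<otimes> j\<close> can be
      nonzero, so the matrix product collapses to one term.\<close>
    obtain r where r: "r \<in> I" "inv r \<otimes> (y \<otimes> j) \<in> W"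
      and r_unique: "\<And>l. l \<in> I \<Longrightarrow> inv l \<otimes> (y \<otimes> j) \<in> W \<Longrightarrow> l = r"
      using I(2)[of "y \<otimes> j"] xy c by blast
    have rc: "r \<in> carrier G" using r I(1) by auto
    have "A y l j = 0" if "l \<in> I" "l \<noteq> r" for l
    proof -
      have "inv l \<otimes> (y \<otimes> j) \<notin> W" using r_unique that by blast
      then show ?thesis using that I(1) xy c by (auto simp: A_def extend_by_0_def m_assoc subset_iff)
    qed
    then have "(\<Sum>l\<in>I. A x i l * A y l j) = A x i r * A y r j"
      by (subst sum.remove[OF finI r(1)]) simp
    also have "\<dots> = ?\<chi> (inv i \<otimes> x \<otimes> r) * \<chi> (inv r \<otimes> (y \<otimes> j))"
      using r xy c rc by (simp add: A_def extend_by_0_def m_assoc)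
    also have "\<dots> = ?\<chi> ((inv i \<otimes> x \<otimes> r) \<otimes> (inv r \<otimes> (y \<otimes> j)))"
      using r xy c rc assms(2) \<chi> by (simp add: extend_by_0_mult_right)
    also have "(inv i \<otimes> x \<otimes> r) \<otimes> (inv r \<otimes> (y \<otimes> j)) = inv i \<otimes> (x \<otimes> y) \<otimes> j"
      using xy c rc by (simp add: m_assoc mult_inv_mult)
    finally show "A (x \<otimes> y) i j = (\<Sum>l\<in>I. A x i l * A y l j)"
      by (simp add: A_def)
  qed
  moreover have "induced W \<chi> \<sigma> = (\<Sum>i\<in>I. A \<sigma> i i)" if \<sigma>: "\<sigma> \<in> carrier G" for \<sigma>
  proof -
    \<comment> \<open>Each group element is uniquely a representative times an element of
      \<open>W\<close>. Conjugating by the second factor does not change the summand, so every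
      diagonal entry occurs |W| times and the average becomes the trace.\<close>
    have bij: "bij_betw (\<lambda>(i, w). i \<otimes> w) (I \<times> W) (carrier G)"
    proof (rule bij_betw_imageI)
      show "inj_on (\<lambda>(i, w). i \<otimes> w) (I \<times> W)"
      proof (rule inj_onI, clarify)
        fix i w j v assume iw: "i \<in> I" "w \<in> W" "j \<in> I" "v \<in> W" "i \<otimes> w = j \<otimes> v"
        have c: "i \<in> carrier G" "j \<in> carrier G" "w \<in> carrier G" "v \<in> carrier G"
          using iw I(1) by auto
        have "inv i \<otimes> j = w \<otimes> inv v"
          using iw(5) c by (metis inv_closed inv_solve_left inv_solve_right m_assoc m_closed)
        then have "inv i \<otimes> j \<in> W" using iw by simp
        then have "i = j" using unique iw by blast
        then show "i = j \<and> w = v" using iw(5) c by simp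
      qed
      show "(\<lambda>(i, w). i \<otimes> w) ` (I \<times> W) = carrier G"
      proof
        show "(\<lambda>(i, w). i \<otimes> w) ` (I \<times> W) \<subseteq> carrier G"
          using I(1) by auto
        show "carrier G \<subseteq> (\<lambda>(i, w). i \<otimes> w) ` (I \<times> W)"
        proof
          fix g assume g: "g \<in> carrier G"
          then obtain r where r: "r \<in> I" "inv r \<otimes> g \<in> W" using I(2) by blast
          then have "g = r \<otimes> (inv r \<otimes> g)"
            using g I(1) by (simp add: m_assoc[symmetric] subset_iff)
          then show "g \<in> (\<lambda>(i, w). i \<otimes> w) ` (I \<times> W)"
            using r by (intro image_eqI[of _ _ "(r, inv r \<otimes> g)"]) auto
        qed
      qed
    qed
    have "(\<Sum>a\<in>carrier G. ?\<chi> (inv a \<otimes> \<sigma> \<otimes> a)) =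
        (\<Sum>(i, w)\<in>I \<times> W. ?\<chi> (inv (i \<otimes> w) \<otimes> \<sigma> \<otimes> (i \<otimes> w)))"
      by (subst sum.reindex_bij_betw[OF bij, symmetric]) (simp add: case_prod_unfold)
    also have "\<dots> = (\<Sum>(i, w)\<in>I \<times> W. A \<sigma> i i)"
    proof (rule sum.cong, rule refl, clarify)
      fix i w assume iw: "i \<in> I" "w \<in> W"
      have c: "i \<in> carrier G" "w \<in> carrier G" using iw I(1) by auto
      have "?\<chi> (inv (i \<otimes> w) \<otimes> \<sigma> \<otimes> (i \<otimes> w)) = ?\<chi> (inv w \<otimes> (inv i \<otimes> \<sigma> \<otimes> i) \<otimes> w)"
        using c \<sigma> by (simp add: inv_mult_group m_assoc)
      also have "\<dots> = A \<sigma> i i"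
        unfolding A_def using c \<sigma> iw by (intro extend_by_0_conjugate assms) auto
      finally show "?\<chi> (inv (i \<otimes> w) \<otimes> \<sigma> \<otimes> (i \<otimes> w)) = A \<sigma> i i" .
    qed
    also have "\<dots> = of_nat (card W) * (\<Sum>i\<in>I. A \<sigma> i i)"
      by (simp add: sum.cartesian_product[symmetric] sum_distrib_left)
    moreover have "card W \<noteq> 0"
      using W.one_closed W.subset assms(1) by (metis card_0_eq empty_iff finite_subset)
    ultimately show ?thesis by (simp add: induced_def)
  qed
  ultimately show ?thesis by (rule that)
qed

end


section \<open>Tuples with trivial common stabilizer\<close>

context group
begin

text \<open>The intersection of the conjugates of the \<open>W m\<close> by the \<open>a m\<close>,
  equivalently the stabilizer of the tuple of left cosets of \<open>a m\<close> modulo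
  \<open>W m\<close>. The membership form has the same conjugate as the summands of
  \<open>induced\<close>.\<close>

definition common_stabilizer :: "'j set \<Rightarrow> ('j \<Rightarrow> 'a set) \<Rightarrow> ('j \<Rightarrow> 'a) \<Rightarrow> 'a set" where
  "common_stabilizer J W a = {g \<in> carrier G. \<forall>m\<in>J. inv (a m) \<otimes> g \<otimes> a m \<in> W m}"

text \<open>Its classes are the double cosets, in the \<open>J\<close>-fold power of the group, of
  the diagonal subgroup on the left and the product of the \<open>W m\<close> on the right.\<close>

definition double_coset_rel :: "'j set \<Rightarrow> ('j \<Rightarrow> 'a set) \<Rightarrow> ('j \<Rightarrow> 'a) rel" where
  "double_coset_rel J W = {(a, b). a \<in> (\<Pi>\<^sub>E m\<in>J. carrier G) \<and> b \<in> (\<Pi>\<^sub>E m\<in>J. carrier G) \<and>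
     (\<exists>\<zeta>\<in>carrier G. \<exists>w. \<forall>m\<in>J. w m \<in> W m \<and> b m = \<zeta> \<otimes> a m \<otimes> w m)}"

lemma double_coset_relE:
  assumes "(a, b) \<in> double_coset_rel J W"
  obtains \<zeta> w where "a \<in> (\<Pi>\<^sub>E m\<in>J. carrier G)" "b \<in> (\<Pi>\<^sub>E m\<in>J. carrier G)" "\<zeta> \<in> carrier G"
    "\<And>m. m \<in> J \<Longrightarrow> w m \<in> W m \<and> b m = \<zeta> \<otimes> a m \<otimes> w m"
proof -
  obtain \<zeta> w where "a \<in> (\<Pi>\<^sub>E m\<in>J. carrier G)" "b \<in> (\<Pi>\<^sub>E m\<in>J. carrier G)" "\<zeta> \<in> carrier G"
    "\<forall>m\<in>J. w m \<in> W m \<and> b m = \<zeta> \<otimes> a m \<otimes> w m"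
    using assms unfolding double_coset_rel_def by blast
  then show ?thesis by (intro that) blast+
qed

lemma subgroup_common_stabilizer:
  assumes W: "\<And>m. m \<in> J \<Longrightarrow> subgroup (W m) G" and a: "\<And>m. m \<in> J \<Longrightarrow> a m \<in> carrier G"
  shows "subgroup (common_stabilizer J W a) G"
proof (rule subgroupI)
  show "common_stabilizer J W a \<subseteq> carrier G" by (auto simp: common_stabilizer_def)
  have "\<one> \<in> common_stabilizer J W a"
    using W a by (auto simp: common_stabilizer_def subgroup.one_closed)
  then show "common_stabilizer J W a \<noteq> {}" by blast
next
  fix g assume g: "g \<in> common_stabilizer J W a"
  show "inv g \<in> common_stabilizer J W a"
    unfolding common_stabilizer_def
  proof (intro CollectI conjI ballI)
    fix m assume m: "m \<in> J"
    have "inv (inv (a m) \<otimes> g \<otimes> a m) \<in> W m"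
      using W[OF m] g m by (auto simp: common_stabilizer_def intro: subgroup.m_inv_closed)
    then show "inv (a m) \<otimes> inv g \<otimes> a m \<in> W m"
      using a[OF m] g by (simp add: common_stabilizer_def inv_mult_group m_assoc)
  qed (use g in \<open>simp add: common_stabilizer_def\<close>)
next
  fix g h assume gh: "g \<in> common_stabilizer J W a" "h \<in> common_stabilizer J W a"
  show "g \<otimes> h \<in> common_stabilizer J W a"
    unfolding common_stabilizer_def
  proof (intro CollectI conjI ballI)
    fix m assume m: "m \<in> J"
    have "(inv (a m) \<otimes> g \<otimes> a m) \<otimes> (inv (a m) \<otimes> h \<otimes> a m) \<in> W m"
      using W[OF m] gh m by (auto simp: common_stabilizer_def intro: subgroup.m_closed)
    then show "inv (a m) \<otimes> (g \<otimes> h) \<otimes> a m \<in> W m"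
      using a[OF m] gh by (simp add: common_stabilizer_def m_assoc mult_inv_mult)
  qed (use gh in \<open>simp add: common_stabilizer_def\<close>)
qed

text \<open>Translating the summation variable by \<open>g\<close> multiplies the sum by
  \<open>\<psi> g\<close>. If \<open>g\<close> is not the identity, injectivity gives
  \<open>\<psi> g \<noteq> 1\<close>, so the sum must vanish in an integral domain.\<close>

lemma sum_injective_character:
  fixes \<psi> :: "'a \<Rightarrow> 'k :: idom"
  assumes "subgroup H G" "finite H" "inj_on \<psi> H" "\<psi> \<one> = 1"
    and mult: "\<And>g h. g \<in> H \<Longrightarrow> h \<in> H \<Longrightarrow> \<psi> (g \<otimes> h) = \<psi> g * \<psi> h"
  shows "(\<Sum>h\<in>H. \<psi> h) = (if H = {\<one>} then 1 else 0)"
proof (cases "H = {\<one>}")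
  case True
  then show ?thesis using assms(4) by simp
next
  case False
  interpret H: subgroup H G by fact
  obtain g where g: "g \<in> H" "g \<noteq> \<one>" using False H.one_closed by auto
  then have "\<psi> g \<noteq> 1" using assms(3,4) H.one_closed by (metis inj_onD)
  have "bij_betw (\<lambda>h. g \<otimes> h) H H"
    by (rule bij_betw_byWitness[where f' = "\<lambda>h. inv g \<otimes> h"])
      (use g in \<open>auto simp: m_assoc[symmetric]\<close>)
  then have "(\<Sum>h\<in>H. \<psi> h) = (\<Sum>h\<in>H. \<psi> (g \<otimes> h))"
    by (rule sum.reindex_bij_betw[symmetric])
  also have "\<dots> = \<psi> g * (\<Sum>h\<in>H. \<psi> h)"
    using g mult by (simp add: sum_distrib_left)
  finally have "(1 - \<psi> g) * (\<Sum>h\<in>H. \<psi> h) = 0" by (simp add: algebra_simps)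
  then show ?thesis using \<open>\<psi> g \<noteq> 1\<close> False by simp
qed

text \<open>The product vanishes unless every conjugate of \<sigma> lies in its \<open>W m\<close>,
  which confines the sum to the common stabilizer. There only the factor \<open>j\<close> differs
  from 1, and conjugation by \<open>a j\<close> keeps it an injective character.\<close>

lemma sum_prod_extend_by_0:
  fixes \<chi> :: "'j \<Rightarrow> 'a \<Rightarrow> 'k :: field_char_0"
  assumes "finite (carrier G)" "finite J" "j \<in> J"
    and W: "\<And>m. m \<in> J \<Longrightarrow> subgroup (W m) G" and a: "\<And>m. m \<in> J \<Longrightarrow> a m \<in> carrier G"
    and trivial: "\<And>m. m \<in> J \<Longrightarrow> m \<noteq> j \<Longrightarrow> \<chi> m = (\<lambda>_. 1)"
    and inj: "inj_on (\<chi> j) (W j)" and one: "\<chi> j \<one> = 1"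
    and mult: "\<And>v w. v \<in> W j \<Longrightarrow> w \<in> W j \<Longrightarrow> \<chi> j (v \<otimes> w) = \<chi> j v * \<chi> j w"
  shows "(\<Sum>\<sigma>\<in>carrier G. \<Prod>m\<in>J. extend_by_0 (W m) (\<chi> m) (inv (a m) \<otimes> \<sigma> \<otimes> a m)) =
    (if common_stabilizer J W a = {\<one>} then 1 else 0)"
proof -
  let ?A = "common_stabilizer J W a"
  let ?\<psi> = "\<lambda>\<sigma>. \<chi> j (inv (a j) \<otimes> \<sigma> \<otimes> a j)"
  let ?f = "\<lambda>\<sigma>. \<Prod>m\<in>J. extend_by_0 (W m) (\<chi> m) (inv (a m) \<otimes> \<sigma> \<otimes> a m)"
  have sub: "subgroup ?A G" using W a by (rule subgroup_common_stabilizer)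
  have AG: "?A \<subseteq> carrier G" by (auto simp: common_stabilizer_def)
  have f0: "?f \<sigma> = 0" if \<sigma>: "\<sigma> \<in> carrier G - ?A" for \<sigma>
  proof -
    obtain m where "m \<in> J" "inv (a m) \<otimes> \<sigma> \<otimes> a m \<notin> W m"
      using \<sigma> by (auto simp: common_stabilizer_def)
    then show ?thesis using assms(2) by (intro prod_zero) (auto simp: extend_by_0_def)
  qed
  have f1: "?f \<sigma> = ?\<psi> \<sigma>" if \<sigma>: "\<sigma> \<in> ?A" for \<sigma>
  proof -
    have "?f \<sigma> = (\<Prod>m\<in>J. \<chi> m (inv (a m) \<otimes> \<sigma> \<otimes> a m))"
      using \<sigma> by (intro prod.cong) (auto simp: common_stabilizer_def extend_by_0_def)
    also have "\<dots> = ?\<psi> \<sigma>"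
      using trivial by (subst prod.remove[OF assms(2,3)]) (simp add: prod.neutral)
    finally show ?thesis .
  qed
  have aj: "a j \<in> carrier G" using a assms(3) .
  have Aj: "inv (a j) \<otimes> g \<otimes> a j \<in> W j" "g \<in> carrier G" if "g \<in> ?A" for g
    using that assms(3) by (auto simp: common_stabilizer_def)
  have "(\<Sum>\<sigma>\<in>carrier G. ?f \<sigma>) = (\<Sum>\<sigma>\<in>?A. ?\<psi> \<sigma>)"
    using f0 f1 by (subst sum.mono_neutral_right[OF assms(1) AG]) (auto intro!: sum.cong)
  also have "\<dots> = (if ?A = {\<one>} then 1 else 0)"
  proof (rule sum_injective_character[OF sub])
    show "finite ?A" using AG assms(1) by (rule finite_subset)
    show "inj_on ?\<psi> ?A"
    proof (rule inj_onI)
      fix g h assume gh: "g \<in> ?A" "h \<in> ?A" "?\<psi> g = ?\<psi> h"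
      then have "inv (a j) \<otimes> g \<otimes> a j = inv (a j) \<otimes> h \<otimes> a j"
        using inj Aj by (auto dest: inj_onD)
      then show "g = h" using aj Aj gh by simp
    qed
    show "?\<psi> \<one> = 1" using aj one by simp
    fix g h assume gh: "g \<in> ?A" "h \<in> ?A"
    have "inv (a j) \<otimes> (g \<otimes> h) \<otimes> a j = (inv (a j) \<otimes> g \<otimes> a j) \<otimes> (inv (a j) \<otimes> h \<otimes> a j)"
      using aj Aj gh by (simp add: m_assoc mult_inv_mult)
    then show "?\<psi> (g \<otimes> h) = ?\<psi> g * ?\<psi> h" using mult Aj gh by simp
  qed
  finally show ?thesis .
qed

section \<open>Sizes and number of the free double cosets\<close>

lemma equiv_double_coset_rel:
  assumes W: "\<And>m. m \<in> J \<Longrightarrow> subgroup (W m) G"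
  shows "equiv (\<Pi>\<^sub>E m\<in>J. carrier G) (double_coset_rel J W)"
proof (rule equivI)
  have WG: "w \<in> carrier G" if "m \<in> J" "w \<in> W m" for m w
    using subgroup.mem_carrier[OF W[OF that(1)]] that(2) .
  show "double_coset_rel J W \<subseteq> (\<Pi>\<^sub>E m\<in>J. carrier G) \<times> (\<Pi>\<^sub>E m\<in>J. carrier G)"
    by (auto simp: double_coset_rel_def)
  show "refl_on (\<Pi>\<^sub>E m\<in>J. carrier G) (double_coset_rel J W)"
  proof (rule refl_onI)
    fix a assume a: "a \<in> (\<Pi>\<^sub>E m\<in>J. carrier G)"
    have "\<forall>m\<in>J. \<one> \<in> W m \<and> a m = \<one> \<otimes> a m \<otimes> \<one>"
      using a W by (auto simp: PiE_iff subgroup.one_closed)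
    then have "\<exists>\<zeta>\<in>carrier G. \<exists>w. \<forall>m\<in>J. w m \<in> W m \<and> a m = \<zeta> \<otimes> a m \<otimes> w m"
      by (intro bexI[of _ \<one>] exI[of _ "\<lambda>_. \<one>"]) auto
    then show "(a, a) \<in> double_coset_rel J W"
      using a by (simp add: double_coset_rel_def)
  qed
  show "sym (double_coset_rel J W)"
  proof (rule symI)
    fix a b assume "(a, b) \<in> double_coset_rel J W"
    then obtain \<zeta> w where P: "a \<in> (\<Pi>\<^sub>E m\<in>J. carrier G)" "b \<in> (\<Pi>\<^sub>E m\<in>J. carrier G)" and
      \<zeta>: "\<zeta> \<in> carrier G" and w: "\<And>m. m \<in> J \<Longrightarrow> w m \<in> W m \<and> b m = \<zeta> \<otimes> a m \<otimes> w m"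
      by (rule double_coset_relE) (rule that)
    have "inv (w m) \<in> W m \<and> a m = inv \<zeta> \<otimes> b m \<otimes> inv (w m)" if m: "m \<in> J" for m
    proof -
      have "a m \<in> carrier G" "w m \<in> carrier G" using P m w WG by auto
      then show ?thesis using w[OF m] \<zeta> W[OF m]
        by (simp add: subgroup.m_inv_closed m_assoc) (simp add: m_assoc[symmetric])
    qed
    then show "(b, a) \<in> double_coset_rel J W"
      using P \<zeta> unfolding double_coset_rel_def
      by (auto intro!: bexI[of _ "inv \<zeta>"] exI[of _ "\<lambda>m. inv (w m)"])
  qed
  show "trans (double_coset_rel J W)"
  proof (rule transI)
    fix a b c
    assume ab: "(a, b) \<in> double_coset_rel J W" and bc: "(b, c) \<in> double_coset_rel J W"
    obtain \<zeta> w where P: "a \<in> (\<Pi>\<^sub>E m\<in>J. carrier G)" "b \<in> (\<Pi>\<^sub>E m\<in>J. carrier G)" and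
      \<zeta>: "\<zeta> \<in> carrier G" and w: "\<And>m. m \<in> J \<Longrightarrow> w m \<in> W m \<and> b m = \<zeta> \<otimes> a m \<otimes> w m"
      using ab by (rule double_coset_relE) (rule that)
    obtain \<xi> v where P': "b \<in> (\<Pi>\<^sub>E m\<in>J. carrier G)" "c \<in> (\<Pi>\<^sub>E m\<in>J. carrier G)" and
      \<xi>: "\<xi> \<in> carrier G" and v: "\<And>m. m \<in> J \<Longrightarrow> v m \<in> W m \<and> c m = \<xi> \<otimes> b m \<otimes> v m"
      using bc by (rule double_coset_relE) (rule that)
    have "w m \<otimes> v m \<in> W m \<and> c m = (\<xi> \<otimes> \<zeta>) \<otimes> a m \<otimes> (w m \<otimes> v m)" if m: "m \<in> J" for m
    proof -
      have "a m \<in> carrier G" "w m \<in> carrier G" "v m \<in> carrier G" using P m w v WG by auto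
      then show ?thesis using w[OF m] v[OF m] \<zeta> \<xi> W[OF m]
        by (simp add: subgroup.m_closed m_assoc)
    qed
    then show "(a, c) \<in> double_coset_rel J W"
      using P P' \<zeta> \<xi> unfolding double_coset_rel_def
      by (auto intro!: bexI[of _ "\<xi> \<otimes> \<zeta>"] exI[of _ "\<lambda>m. w m \<otimes> v m"])
  qed
qed

text \<open>Conjugation by \<zeta> relates the two common stabilizers; the factors
  \<open>w m\<close> have no effect because \<open>W m\<close> is closed under conjugation by its
  own elements.\<close>

lemma common_stabilizer_trivial_cong:
  assumes W: "\<And>m. m \<in> J \<Longrightarrow> subgroup (W m) G"
    and ab: "(a, b) \<in> double_coset_rel J W" and triv: "common_stabilizer J W a = {\<one>}"
  shows "common_stabilizer J W b = {\<one>}"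
proof -
  obtain \<zeta> w where P: "a \<in> (\<Pi>\<^sub>E m\<in>J. carrier G)" "b \<in> (\<Pi>\<^sub>E m\<in>J. carrier G)" and
    \<zeta>: "\<zeta> \<in> carrier G" and w: "\<And>m. m \<in> J \<Longrightarrow> w m \<in> W m \<and> b m = \<zeta> \<otimes> a m \<otimes> w m"
    using ab by (rule double_coset_relE) (rule that)
  have sub: "subgroup (common_stabilizer J W b) G"
    using W P by (intro subgroup_common_stabilizer) auto
  have "g = \<one>" if g: "g \<in> common_stabilizer J W b" for g
  proof -
    have gG: "g \<in> carrier G" using g by (simp add: common_stabilizer_def)
    have "inv \<zeta> \<otimes> g \<otimes> \<zeta> \<in> common_stabilizer J W a"
      unfolding common_stabilizer_def
    proof (intro CollectI conjI ballI)
      show "inv \<zeta> \<otimes> g \<otimes> \<zeta> \<in> carrier G" using gG \<zeta> by simp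
      fix m assume m: "m \<in> J"
      interpret Wm: subgroup "W m" G using W m .
      have c: "a m \<in> carrier G" "w m \<in> carrier G" using P m w by auto
      have "w m \<otimes> (inv (b m) \<otimes> g \<otimes> b m) \<otimes> inv (w m) \<in> W m"
        using g m w[OF m] by (auto simp: common_stabilizer_def)
      also have "w m \<otimes> (inv (b m) \<otimes> g \<otimes> b m) \<otimes> inv (w m) =
          inv (a m) \<otimes> (inv \<zeta> \<otimes> g \<otimes> \<zeta>) \<otimes> a m"
        using w[OF m] c gG \<zeta> by (simp add: inv_mult_group m_assoc mult_inv_mult)
      finally show "inv (a m) \<otimes> (inv \<zeta> \<otimes> g \<otimes> \<zeta>) \<otimes> a m \<in> W m" .
    qed
    then have "inv \<zeta> \<otimes> g \<otimes> \<zeta> = \<one>" using triv by simp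
    then have "\<zeta> \<otimes> (inv \<zeta> \<otimes> g \<otimes> \<zeta>) \<otimes> inv \<zeta> = \<one>" using \<zeta> by simp
    then show ?thesis using gG \<zeta> by (simp add: m_assoc mult_inv_mult)
  qed
  then show ?thesis using subgroup.one_closed[OF sub] by blast
qed

text \<open>
  The stabilizer of \<open>a\<close> under \<open>(\<zeta>, w) \<mapsto> (\<zeta> a\<^sub>m w\<^sub>m)\<^sub>m\<close> is isomorphic to the common stabilizer, so
  the action is free here.
\<close>

lemma card_free_double_coset:
  assumes "finite J" "J \<noteq> {}" and W: "\<And>m. m \<in> J \<Longrightarrow> subgroup (W m) G"
    and a: "a \<in> (\<Pi>\<^sub>E m\<in>J. carrier G)" and triv: "common_stabilizer J W a = {\<one>}"
  shows "card (double_coset_rel J W `` {a}) = card (carrier G) * (\<Prod>m\<in>J. card (W m))"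
proof -
  define act where "act = (\<lambda>(\<zeta>, w). \<lambda>m\<in>J. \<zeta> \<otimes> a m \<otimes> w m)"
  have WG: "w \<in> carrier G" if "m \<in> J" "w \<in> W m" for m w
    using subgroup.mem_carrier[OF W[OF that(1)]] that(2) .
  have aG: "a m \<in> carrier G" if "m \<in> J" for m using a that by auto
  have "double_coset_rel J W `` {a} = act ` (carrier G \<times> (\<Pi>\<^sub>E m\<in>J. W m))"
  proof
    show "double_coset_rel J W `` {a} \<subseteq> act ` (carrier G \<times> (\<Pi>\<^sub>E m\<in>J. W m))"
    proof
      fix b assume "b \<in> double_coset_rel J W `` {a}"
      then have "(a, b) \<in> double_coset_rel J W" by simp
      then obtain \<zeta> w where b: "a \<in> (\<Pi>\<^sub>E m\<in>J. carrier G)" "b \<in> (\<Pi>\<^sub>E m\<in>J. carrier G)" and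
        \<zeta>: "\<zeta> \<in> carrier G" and w: "\<And>m. m \<in> J \<Longrightarrow> w m \<in> W m \<and> b m = \<zeta> \<otimes> a m \<otimes> w m"
        by (rule double_coset_relE) (rule that)
      \<comment> \<open>The relation leaves \<open>w\<close> arbitrary outside \<open>J\<close>;
        restricting it gives a point of the extensional product, on which the action can be
        injective.\<close>
      have "b = act (\<zeta>, restrict w J)"
      proof
        fix m
        show "b m = act (\<zeta>, restrict w J) m"
          using w[of m] PiE_arb[OF b(2), of m] by (cases "m \<in> J") (simp_all add: act_def)
      qed
      then show "b \<in> act ` (carrier G \<times> (\<Pi>\<^sub>E m\<in>J. W m))"
        using \<zeta> w by (intro image_eqI[of _ _ "(\<zeta>, restrict w J)"]) simp_all
    qed
    show "act ` (carrier G \<times> (\<Pi>\<^sub>E m\<in>J. W m)) \<subseteq> double_coset_rel J W `` {a}"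
    proof clarify
      fix \<zeta> w assume \<zeta>: "\<zeta> \<in> carrier G" and w: "w \<in> (\<Pi>\<^sub>E m\<in>J. W m)"
      have "act (\<zeta>, w) \<in> (\<Pi>\<^sub>E m\<in>J. carrier G)"
        using \<zeta> w aG WG by (auto simp: act_def PiE_iff)
      moreover have "\<forall>m\<in>J. w m \<in> W m \<and> act (\<zeta>, w) m = \<zeta> \<otimes> a m \<otimes> w m"
        using w by (auto simp: act_def)
      ultimately show "(a, act (\<zeta>, w)) \<in> double_coset_rel J W"
        using a \<zeta> unfolding double_coset_rel_def by blast
    qed
  qed
  moreover have "inj_on act (carrier G \<times> (\<Pi>\<^sub>E m\<in>J. W m))"
  proof (rule inj_onI, clarify)
    fix \<zeta> w \<xi> v
    assume \<zeta>: "\<zeta> \<in> carrier G" "\<xi> \<in> carrier G"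
      and w: "w \<in> (\<Pi>\<^sub>E m\<in>J. W m)" "v \<in> (\<Pi>\<^sub>E m\<in>J. W m)" and eq: "act (\<zeta>, w) = act (\<xi>, v)"
    have eq': "\<zeta> \<otimes> a m \<otimes> w m = \<xi> \<otimes> a m \<otimes> v m" if "m \<in> J" for m
      using fun_cong[OF eq, of m] that by (simp add: act_def)
    \<comment> \<open>Two pairs with the same image differ on the left by an element whose conjugate
      by \<open>a m\<close> is \<open>v m \<otimes> inv (w m)\<close>, hence in
      \<open>W m\<close>.\<close>
    have "inv \<xi> \<otimes> \<zeta> \<in> common_stabilizer J W a"
      unfolding common_stabilizer_def
    proof (intro CollectI conjI ballI)
      show "inv \<xi> \<otimes> \<zeta> \<in> carrier G" using \<zeta> by simp
      fix m assume m: "m \<in> J"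
      interpret Wm: subgroup "W m" G using W m .
      have wW: "w m \<in> W m" "v m \<in> W m" using w m by auto
      then have c: "w m \<in> carrier G" "v m \<in> carrier G" by auto
      have "inv (a m) \<otimes> (inv \<xi> \<otimes> \<zeta>) \<otimes> a m =
          inv (a m) \<otimes> inv \<xi> \<otimes> (\<zeta> \<otimes> a m \<otimes> w m) \<otimes> inv (w m)"
        using \<zeta> c aG[OF m] by (simp add: m_assoc)
      also have "\<dots> = inv (\<xi> \<otimes> a m) \<otimes> (\<xi> \<otimes> a m \<otimes> v m) \<otimes> inv (w m)"
        using \<zeta> c aG[OF m] eq'[OF m] by (simp add: inv_mult_group)
      also have "\<dots> = v m \<otimes> inv (w m)"
        using \<zeta> c aG[OF m] by (simp add: inv_mult_group m_assoc inv_mult_mult)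
      finally show "inv (a m) \<otimes> (inv \<xi> \<otimes> \<zeta>) \<otimes> a m \<in> W m" using wW by simp
    qed
    then have "inv \<xi> \<otimes> \<zeta> = \<one>" using triv by simp
    then have \<zeta>\<xi>: "\<zeta> = \<xi>" using \<zeta> mult_inv_mult[of \<xi> \<zeta>] by simp
    have "w m = v m" if m: "m \<in> J" for m
    proof -
      have "w m \<in> carrier G" "v m \<in> carrier G" using w m WG by auto
      then show ?thesis using eq'[OF m] \<zeta>\<xi> \<zeta> aG[OF m] by simp
    qed
    with w have "w = v" by (rule PiE_ext)
    then show "\<zeta> = \<xi> \<and> w = v" using \<zeta>\<xi> by simp
  qed
  ultimately show ?thesis
    using assms(1) by (simp add: card_image card_cartesian_product card_PiE)
qed

text \<open>Triviality of the common stabilizer is constant on classes, so the free tuples are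
  partitioned by whole classes of one common size.\<close>

lemma card_free_double_cosets:
  assumes fin: "finite (carrier G)" and J: "finite J" "J \<noteq> {}"
    and W: "\<And>m. m \<in> J \<Longrightarrow> subgroup (W m) G"
  shows "card {S \<in> (\<Pi>\<^sub>E m\<in>J. carrier G) // double_coset_rel J W.
        \<forall>a\<in>S. common_stabilizer J W a = {\<one>}} * (card (carrier G) * (\<Prod>m\<in>J. card (W m))) =
    card {a \<in> (\<Pi>\<^sub>E m\<in>J. carrier G). common_stabilizer J W a = {\<one>}}"
    (is "card ?F * ?N = card ?Q")
proof -
  let ?P = "\<Pi>\<^sub>E m\<in>J. carrier G"
  have equiv: "equiv ?P (double_coset_rel J W)" using W by (rule equiv_double_coset_rel)
  have finP: "finite ?P" using fin J by (simp add: finite_PiE)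
  have "\<Union>?F = ?Q"
  proof
    show "\<Union>?F \<subseteq> ?Q" using Union_quotient[OF equiv] by auto
    show "?Q \<subseteq> \<Union>?F"
    proof
      fix a assume "a \<in> ?Q"
      then have a: "a \<in> ?P" "common_stabilizer J W a = {\<one>}" by blast+
      have "common_stabilizer J W b = {\<one>}" if "b \<in> double_coset_rel J W `` {a}" for b
        using that by (intro common_stabilizer_trivial_cong[OF W _ a(2)]) simp_all
      moreover have "double_coset_rel J W `` {a} \<in> ?P // double_coset_rel J W"
        using a(1) by (rule quotientI)
      ultimately have "double_coset_rel J W `` {a} \<in> ?F" by blast
      moreover have "a \<in> double_coset_rel J W `` {a}"
        using a equiv_class_self[OF equiv] by auto
      ultimately show "a \<in> \<Union>?F" by blast
    qed
  qed
  moreover have "card S = ?N" if S: "S \<in> ?F" for S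
  proof -
    obtain a where a: "a \<in> ?P" "S = double_coset_rel J W `` {a}"
      using S by (auto elim: quotientE)
    moreover have "a \<in> S" using a equiv_class_self[OF equiv] by auto
    ultimately show ?thesis using card_free_double_coset[OF J W] S by simp
  qed
  moreover have "pairwise disjnt ?F"
    using quotient_disj[OF equiv] by (auto simp: pairwise_def disjnt_def)
  moreover have "finite S" if "S \<in> ?F" for S
    using that Union_quotient[OF equiv] finP by (auto intro: finite_subset)
  ultimately show ?thesis
    using card_Union_disjoint[of ?F] by simp
qed

end


section \<open>The characteristic map on characters\<close>

text \<open>An enumeration \<open>e\<close> of the index set turns the entries into an actual matrix
  without changing the trace.\<close>

lemma matrix_rep_trace_sym_characters:
  fixes A :: "(nat \<Rightarrow> nat) \<Rightarrow> 'i \<Rightarrow> 'i \<Rightarrow> 'a :: field_char_0"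
  assumes rep: "matrix_rep (sym_group d) I A"
  shows "(\<lambda>\<sigma>\<in>carrier (sym_group d). \<Sum>i\<in>I. A \<sigma> i i) \<in> sym_characters d"
proof -
  interpret S: group "sym_group d" by (rule sym_group_is_group)
  have "finite I" using rep by (simp add: matrix_rep_def)
  then obtain e where "bij_betw e {0..<card I} I" using ex_bij_betw_nat_finite by blast
  moreover define n where "n = card I"
  ultimately have e: "bij_betw e {0..<n} I" by simp
  have eI: "e i \<in> I" if "i < n" for i using e that by (auto simp: bij_betw_def)
  have e_eq: "e i = e j \<longleftrightarrow> i = j" if "i < n" "j < n" for i j
    using e that by (auto simp: bij_betw_def inj_on_def)
  define T where "T \<sigma> = mat n n (\<lambda>(i, j). A \<sigma> (e i) (e j))" for \<sigma>
  let ?R = "ring_mat TYPE('a) n ()"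
  have one: "T \<one>\<^bsub>sym_group d\<^esub> = 1\<^sub>m n"
    by (rule eq_matI) (use rep eI e_eq in \<open>auto simp: T_def matrix_rep_def\<close>)
  have mult: "T (\<sigma> \<otimes>\<^bsub>sym_group d\<^esub> \<tau>) = T \<sigma> * T \<tau>"
    if "\<sigma> \<in> carrier (sym_group d)" "\<tau> \<in> carrier (sym_group d)" for \<sigma> \<tau>
  proof (rule eq_matI)
    fix i j assume "i < dim_row (T \<sigma> * T \<tau>)" "j < dim_col (T \<sigma> * T \<tau>)"
    then have ij: "i < n" "j < n" by (simp_all add: T_def)
    have "A (\<sigma> \<otimes>\<^bsub>sym_group d\<^esub> \<tau>) (e i) (e j) = (\<Sum>l\<in>I. A \<sigma> (e i) l * A \<tau> l (e j))"
      using rep that eI ij by (auto simp: matrix_rep_def)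
    also have "\<dots> = (\<Sum>l=0..<n. A \<sigma> (e i) (e l) * A \<tau> (e l) (e j))"
      by (rule sum.reindex_bij_betw[OF e, symmetric])
    finally show "T (\<sigma> \<otimes>\<^bsub>sym_group d\<^esub> \<tau>) $$ (i, j) = (T \<sigma> * T \<tau>) $$ (i, j)"
      using ij by (simp add: T_def scalar_prod_def)
  qed (simp_all add: T_def)
  have carrier: "T \<sigma> \<in> carrier_mat n n" for \<sigma> by (simp add: T_def)
  have "T \<in> hom (sym_group d) (units_of ?R)"
  proof (rule homI)
    fix \<sigma> assume \<sigma>: "\<sigma> \<in> carrier (sym_group d)"
    \<comment> \<open>Units are required as values; the matrix of the inverse permutation is the
      inverse matrix.\<close>
    let ?\<tau> = "inv\<^bsub>sym_group d\<^esub> \<sigma>"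
    have "T \<sigma> * T ?\<tau> = 1\<^sub>m n" "T ?\<tau> * T \<sigma> = 1\<^sub>m n"
      using \<sigma> one by (simp_all only: mult[symmetric] S.inv_closed S.r_inv S.l_inv)
    then show "T \<sigma> \<in> carrier (units_of ?R)"
      using carrier by (auto simp: units_of_def Units_def ring_mat_simps)
  next
    fix \<sigma> \<tau> assume "\<sigma> \<in> carrier (sym_group d)" "\<tau> \<in> carrier (sym_group d)"
    then show "T (\<sigma> \<otimes>\<^bsub>sym_group d\<^esub> \<tau>) = T \<sigma> \<otimes>\<^bsub>units_of ?R\<^esub> T \<tau>"
      using mult by (simp add: units_of_mult ring_mat_simps)
  qed
  moreover have "mat_trace (T \<sigma>) = (\<Sum>i\<in>I. A \<sigma> i i)" for \<sigma>
    using sum.reindex_bij_betw[OF e, of "\<lambda>i. A \<sigma> i i"]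
    by (simp add: mat_trace_def T_def lessThan_atLeast0)
  ultimately show ?thesis
    unfolding sym_characters_def by (intro CollectI exI[of _ T] exI[of _ n]) simp
qed

lemma sym_characters_obtain_matrix_rep:
  assumes "u \<in> sym_characters d"
  obtains I :: "nat set" and A where "matrix_rep (sym_group d) I A"
    "u = (\<lambda>\<sigma>\<in>carrier (sym_group d). \<Sum>i\<in>I. A \<sigma> i i)"
proof -
  obtain T n where T: "T \<in> hom (sym_group d) (units_of (ring_mat TYPE('a) n ()))"
    and u: "u = (\<lambda>\<sigma>\<in>carrier (sym_group d). mat_trace (T \<sigma>))"
    using assms unfolding sym_characters_def by blast
  let ?R = "ring_mat TYPE('a) n ()"
  interpret R: ring ?R by (rule ring_mat)
  interpret S: group "sym_group d" by (rule sym_group_is_group)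
  \<comment> \<open>Membership in \<open>hom\<close> demands only closure and multiplicativity; that
    the identity goes to the identity matrix follows because the target is a group.\<close>
  interpret H: group_hom "sym_group d" "units_of ?R" T
    using T R.units_group by (simp add: group_hom_def group_hom_axioms_def S.group_axioms)
  have carrier: "T \<sigma> \<in> carrier_mat n n" if "\<sigma> \<in> carrier (sym_group d)" for \<sigma>
    using H.hom_closed[OF that] by (auto simp: units_of_def Units_def ring_mat_simps)
  have one: "T \<one>\<^bsub>sym_group d\<^esub> = 1\<^sub>m n"
    using H.hom_one by (simp add: units_of_one ring_mat_simps)
  have mult: "T (\<sigma> \<otimes>\<^bsub>sym_group d\<^esub> \<tau>) = T \<sigma> * T \<tau>"
    if "\<sigma> \<in> carrier (sym_group d)" "\<tau> \<in> carrier (sym_group d)" for \<sigma> \<tau>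
    using H.hom_mult[OF that] by (simp add: units_of_mult ring_mat_simps)
  have "matrix_rep (sym_group d) {..<n} (\<lambda>\<sigma> i j. T \<sigma> $$ (i, j))"
    unfolding matrix_rep_def
  proof (intro conjI ballI)
    fix \<sigma> \<tau> i j
    assume \<sigma>: "\<sigma> \<in> carrier (sym_group d)" and \<tau>: "\<tau> \<in> carrier (sym_group d)"
      and ij: "i \<in> {..<n}" "j \<in> {..<n}"
    show "T (\<sigma> \<otimes>\<^bsub>sym_group d\<^esub> \<tau>) $$ (i, j) = (\<Sum>l\<in>{..<n}. T \<sigma> $$ (i, l) * T \<tau> $$ (l, j))"
      using mult[OF \<sigma> \<tau>] carrier[OF \<sigma>] carrier[OF \<tau>] ij
      by (simp add: scalar_prod_def lessThan_atLeast0)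
  qed (simp_all add: one del: H.hom_one)
  moreover have "u = (\<lambda>\<sigma>\<in>carrier (sym_group d). \<Sum>i<n. T \<sigma> $$ (i, i))"
    unfolding u by (rule restrict_ext) (use carrier in \<open>auto simp: mat_trace_def\<close>)
  ultimately show ?thesis by (rule that)
qed

text \<open>The trace of a tensor product is the product of the traces.\<close>

lemma sym_characters_mult:
  assumes "u \<in> sym_characters d" "v \<in> sym_characters d"
  shows "(\<lambda>\<sigma>\<in>carrier (sym_group d). u \<sigma> * v \<sigma>) \<in> sym_characters d"
proof -
  obtain I :: "nat set" and A where A: "matrix_rep (sym_group d) I A"
    "u = (\<lambda>\<sigma>\<in>carrier (sym_group d). \<Sum>i\<in>I. A \<sigma> i i)"
    using assms(1) by (rule sym_characters_obtain_matrix_rep)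
  obtain J :: "nat set" and B where B: "matrix_rep (sym_group d) J B"
    "v = (\<lambda>\<sigma>\<in>carrier (sym_group d). \<Sum>i\<in>J. B \<sigma> i i)"
    using assms(2) by (rule sym_characters_obtain_matrix_rep)
  have "(\<lambda>\<sigma>\<in>carrier (sym_group d). u \<sigma> * v \<sigma>) =
      (\<lambda>\<sigma>\<in>carrier (sym_group d). \<Sum>p\<in>I \<times> J. A \<sigma> (fst p) (fst p) * B \<sigma> (snd p) (snd p))"
    by (rule restrict_ext) (simp add: A(2) B(2) sum_product sum.cartesian_product case_prod_unfold)
  then show ?thesis
    using matrix_rep_trace_sym_characters[OF matrix_rep_tensor[OF A(1) B(1)]] by simp
qed

lemma sym_characters_class_function:
  assumes "u \<in> sym_characters d" "a permutes {1..d}" "\<tau> permutes {1..d}" "a \<circ> \<tau> = \<sigma> \<circ> a"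
  shows "u \<sigma> = u \<tau>"
proof -
  obtain I :: "nat set" and A where A: "matrix_rep (sym_group d) I A"
    "u = (\<lambda>\<sigma>\<in>carrier (sym_group d). \<Sum>i\<in>I. A \<sigma> i i)"
    using assms(1) by (rule sym_characters_obtain_matrix_rep)
  have ia: "inv' a permutes {1..d}" using assms(2) by (rule permutes_inv)
  \<comment> \<open>Conjugate permutations are products of the same two factors in opposite orders,
    so cyclicity of the trace applies.\<close>
  have \<sigma>: "\<sigma> = a \<circ> (\<tau> \<circ> inv' a)" "\<tau> = (\<tau> \<circ> inv' a) \<circ> a"
    using assms(4) permutes_inv_o[OF assms(2)] by (metis comp_assoc comp_id)+
  have "u (a \<circ> (\<tau> \<circ> inv' a)) = u ((\<tau> \<circ> inv' a) \<circ> a)"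
    using matrix_rep_trace_commute[OF A(1), of a "\<tau> \<circ> inv' a"] assms(2,3) ia
    by (simp add: A(2) sym_group_carrier sym_group_mult permutes_compose)
  then show ?thesis using \<sigma> by metis
qed

lemma sym_characters_subset_generalized:
  assumes "u \<in> sym_characters d"
  shows "u \<in> generalized_characters d"
proof -
  \<comment> \<open>The zero function is the character of the zero-dimensional representation, so a
    character is a difference of two characters.\<close>
  have "matrix_rep (sym_group d) ({} :: nat set) (\<lambda>_ _ _. 0 :: 'a)"
    by (simp add: matrix_rep_def)
  from matrix_rep_trace_sym_characters[OF this]
  have z: "(\<lambda>\<sigma>\<in>carrier (sym_group d). 0) \<in> (sym_characters d :: ((nat \<Rightarrow> nat) \<Rightarrow> 'a) set)"
    by simp
  have "u \<in> extensional (carrier (sym_group d))"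
    using assms by (auto simp: sym_characters_def)
  then have "u = (\<lambda>\<sigma>\<in>carrier (sym_group d). u \<sigma> - (\<lambda>\<sigma>\<in>carrier (sym_group d). 0) \<sigma>)"
    by (auto simp: fun_eq_iff extensional_def)
  then show ?thesis
    unfolding generalized_characters_def using assms z by blast
qed

text \<open>The polynomial witness behind \<open>characteristic_map d u\<close>. Permutations of the
  same cycle type contribute to the same monomial, and adding finitely supported maps collects their
  terms.\<close>

definition char_polynomial ::
    "nat \<Rightarrow> ((nat \<Rightarrow> nat) \<Rightarrow> 'a) \<Rightarrow> nat multiset \<Rightarrow>\<^sub>0 'a :: field_char_0" where
  "char_polynomial d u =
     (\<Sum>\<sigma>\<in>carrier (sym_group d). Poly_Mapping.single (cycle_type d \<sigma>) (u \<sigma> / fact d))"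

lemma eval_power_sums_single:
  "eval_power_sums (Poly_Mapping.single L c) = mfps_const c * power_sum_prod L"
  by (subst eval_power_sums_superset[of "{L}"]) auto

lemma eval_power_sums_sum: "eval_power_sums (sum f S) = (\<Sum>x\<in>S. eval_power_sums (f x))"
proof (induction S rule: infinite_finite_induct)
  case (insert x S)
  then show ?case by (simp add: eval_power_sums_add)
qed (simp_all add: eval_power_sums_def)

lemma characteristic_map_eq_eval: "characteristic_map d u = eval_power_sums (char_polynomial d u)"
proof -
  have "mfps_const (1 / fact d) * (mfps_const (u \<sigma>) * cycle_monomial d \<sigma>) =
      mfps_const (u \<sigma> / fact d) * power_sum_prod (cycle_type d \<sigma>)" for \<sigma>
    by (simp add: mult.assoc[symmetric] mfps_const_mult[symmetric] cycle_monomial_eq_power_sum_prod)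
  then show ?thesis
    by (simp add: characteristic_map_def char_polynomial_def eval_power_sums_sum
        eval_power_sums_single sum_distrib_left)
qed

lemma power_sum_polynomial_characteristic_map:
  "power_sum_polynomial d (characteristic_map d u) = char_polynomial d u"
  unfolding characteristic_map_eq_eval
proof (rule power_sum_polynomial_eval)
  fix L assume "L \<in> Poly_Mapping.keys (char_polynomial d u)"
  then have "L \<in> (\<Union>\<sigma>\<in>carrier (sym_group d).
      Poly_Mapping.keys (Poly_Mapping.single (cycle_type d \<sigma>) (u \<sigma> / fact d)))"
    unfolding char_polynomial_def by (rule subsetD[OF keys_sum])
  then obtain \<sigma> where "L = cycle_type d \<sigma>" by (auto split: if_splits)
  then show "set_mset L \<subseteq> {1..d}" using set_cycle_type by simp
qed

text \<open>Summing coefficients ignores how terms are collected into monomials. The result is the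
  mean of \<open>u\<close>, its inner product with the trivial character.\<close>

lemma coeff_sum_char_polynomial:
  "coeff_sum (char_polynomial d u) = (\<Sum>\<sigma>\<in>carrier (sym_group d). u \<sigma>) / fact d"
proof -
  let ?S = "cycle_type d ` carrier (sym_group d)"
  have "Poly_Mapping.keys (char_polynomial d u) \<subseteq> (\<Union>\<sigma>\<in>carrier (sym_group d).
      Poly_Mapping.keys (Poly_Mapping.single (cycle_type d \<sigma>) (u \<sigma> / fact d)))"
    unfolding char_polynomial_def by (rule keys_sum)
  also have "\<dots> \<subseteq> ?S" by auto
  finally have "coeff_sum (char_polynomial d u) =
      (\<Sum>L\<in>?S. Poly_Mapping.lookup (char_polynomial d u) L)"
    by (intro coeff_sum_superset) auto
  also have "\<dots> = (\<Sum>\<sigma>\<in>carrier (sym_group d). \<Sum>L\<in>?S.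
      if L = cycle_type d \<sigma> then u \<sigma> / fact d else 0)"
    unfolding char_polynomial_def lookup_sum
    by (subst sum.swap) (auto simp: lookup_single when_def intro!: sum.cong)
  also have "\<dots> = (\<Sum>\<sigma>\<in>carrier (sym_group d). u \<sigma> / fact d)"
    by (intro sum.cong) auto
  finally show ?thesis by (simp add: sum_divide_distrib)
qed

text \<open>A generalized character is constant on permutations of a given cycle type, so the
  coefficient at that type is its value times a positive class size over d!. In characteristic zero
  the value can be read off.\<close>

lemma inj_on_characteristic_map:
  "inj_on (characteristic_map d) (generalized_characters d :: ((nat \<Rightarrow> nat) \<Rightarrow> 'a :: field_char_0) set)"
proof (rule inj_onI)
  fix u v :: "(nat \<Rightarrow> nat) \<Rightarrow> 'a"
  assume u: "u \<in> generalized_characters d" and v: "v \<in> generalized_characters d"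
    and eq: "characteristic_map d u = characteristic_map d v"
  have poly: "char_polynomial d u = char_polynomial d v"
    using arg_cong[OF eq, of "power_sum_polynomial d"]
    by (simp only: power_sum_polynomial_characteristic_map)
  have const: "w \<sigma> = w \<tau>" if w: "w \<in> generalized_characters d"
    and \<sigma>\<tau>: "\<sigma> \<in> carrier (sym_group d)" "\<tau> \<in> carrier (sym_group d)"
      "cycle_type d \<sigma> = cycle_type d \<tau>" for w :: "(nat \<Rightarrow> nat) \<Rightarrow> 'a" and \<sigma> \<tau>
  proof -
    obtain w1 w2 where w12: "w1 \<in> sym_characters d" "w2 \<in> sym_characters d"
      "w = (\<lambda>\<sigma>\<in>carrier (sym_group d). w1 \<sigma> - w2 \<sigma>)"
      using w unfolding generalized_characters_def by blast
    obtain a where "a permutes {1..d}" "a \<circ> \<tau> = \<sigma> \<circ> a"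
      using cycle_type_eq_imp_conjugate[of \<sigma> d \<tau>] \<sigma>\<tau> by (auto simp: sym_group_carrier)
    then have "w1 \<sigma> = w1 \<tau>" "w2 \<sigma> = w2 \<tau>"
      using sym_characters_class_function w12 \<sigma>\<tau> by (auto simp: sym_group_carrier)
    then show ?thesis using w12 \<sigma>\<tau> by simp
  qed
  have coeff: "Poly_Mapping.lookup (char_polynomial d w) (cycle_type d \<tau>) =
      of_nat (card {\<sigma> \<in> carrier (sym_group d). cycle_type d \<sigma> = cycle_type d \<tau>}) * (w \<tau> / fact d)"
    if w: "w \<in> generalized_characters d" and \<tau>: "\<tau> \<in> carrier (sym_group d)"
    for w :: "(nat \<Rightarrow> nat) \<Rightarrow> 'a" and \<tau>
  proof -
    have "Poly_Mapping.lookup (char_polynomial d w) (cycle_type d \<tau>) =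
        (\<Sum>\<sigma>\<in>carrier (sym_group d). if cycle_type d \<sigma> = cycle_type d \<tau> then w \<tau> / fact d else 0)"
      unfolding char_polynomial_def lookup_sum
      using const[OF w _ \<tau>] by (intro sum.cong) (auto simp: lookup_single when_def)
    then show ?thesis
      by (simp add: sum.If_cases Int_def)
  qed
  show "u = v"
  proof
    fix \<tau>
    show "u \<tau> = v \<tau>"
    proof (cases "\<tau> \<in> carrier (sym_group d)")
      case True
      define N where "N = card {\<sigma> \<in> carrier (sym_group d). cycle_type d \<sigma> = cycle_type d \<tau>}"
      have "N \<noteq> 0"
        unfolding N_def using True by (subst card_0_eq) auto
      moreover have "of_nat N * (u \<tau> / fact d) = of_nat N * (v \<tau> / fact d)"
        using coeff[OF u True] coeff[OF v True] poly unfolding N_def by metis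
      ultimately show ?thesis by simp
    next
      case False
      then show ?thesis using u v by (auto simp: generalized_characters_def)
    qed
  qed
qed

lemma internal_product_characteristic_map:
  assumes "u \<in> sym_characters d" "v \<in> sym_characters d"
  shows "internal_product d (characteristic_map d u) (characteristic_map d v) =
    characteristic_map d (\<lambda>\<sigma>\<in>carrier (sym_group d). u \<sigma> * v \<sigma>)"
  using assms
  by (simp add: internal_product_def Let_def
      the_inv_into_f_f[OF inj_on_characteristic_map sym_characters_subset_generalized])

text \<open>Every intermediate accumulator must again be the characteristic of a character before
  the next internal product can be evaluated; hence the induction with \<open>u\<close> arbitrary
  and the appeal to \<open>sym_characters_mult\<close>.\<close>

lemma foldl_internal_product:
  assumes "u \<in> sym_characters d" "\<And>m. m \<in> set ms \<Longrightarrow> v m \<in> sym_characters d"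
  shows "foldl (internal_product d) (characteristic_map d u) (map (\<lambda>m. characteristic_map d (v m)) ms) =
    characteristic_map d (\<lambda>\<sigma>\<in>carrier (sym_group d). u \<sigma> * (\<Prod>m\<leftarrow>ms. v m \<sigma>))"
  using assms
proof (induction ms arbitrary: u)
  case Nil
  then have "u \<in> extensional (carrier (sym_group d))"
    by (auto simp: sym_characters_def)
  then show ?case by (simp add: extensional_restrict)
next
  case (Cons m ms)
  let ?w = "\<lambda>\<sigma>\<in>carrier (sym_group d). u \<sigma> * v m \<sigma>"
  have w: "?w \<in> sym_characters d" using Cons.prems by (intro sym_characters_mult) auto
  have "foldl (internal_product d) (characteristic_map d ?w)
      (map (\<lambda>m. characteristic_map d (v m)) ms) =
    characteristic_map d (\<lambda>\<sigma>\<in>carrier (sym_group d). ?w \<sigma> * (\<Prod>m\<leftarrow>ms. v m \<sigma>))"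
    by (rule Cons.IH[OF w]) (simp add: Cons.prems(2))
  also have "(\<lambda>\<sigma>\<in>carrier (sym_group d). ?w \<sigma> * (\<Prod>m\<leftarrow>ms. v m \<sigma>)) =
      (\<lambda>\<sigma>\<in>carrier (sym_group d). u \<sigma> * (\<Prod>m\<leftarrow>m # ms. v m \<sigma>))"
    by (rule restrict_ext) (simp add: mult.assoc)
  finally have "foldl (internal_product d) (characteristic_map d ?w)
      (map (\<lambda>m. characteristic_map d (v m)) ms) =
    characteristic_map d (\<lambda>\<sigma>\<in>carrier (sym_group d). u \<sigma> * (\<Prod>m\<leftarrow>m # ms. v m \<sigma>))" .
  moreover have "internal_product d (characteristic_map d u) (characteristic_map d (v m)) =
      characteristic_map d ?w"
    using Cons.prems by (intro internal_product_characteristic_map) auto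
  ultimately show ?case by (simp only: list.map foldl.simps)
qed


section \<open>Cycle indices and superpositions\<close>

lemma induced_sym_characters:
  fixes \<chi> :: "(nat \<Rightarrow> nat) \<Rightarrow> 'a :: field_char_0"
  assumes "subgroup W (sym_group d)" "one_dim_character d W \<chi>"
  shows "(\<lambda>\<sigma>\<in>carrier (sym_group d). group.induced (sym_group d) W \<chi> \<sigma>) \<in> sym_characters d"
proof -
  interpret S: group "sym_group d" by (rule sym_group_is_group)
  interpret W: subgroup W "sym_group d" by fact
  have mult: "\<chi> (v \<otimes>\<^bsub>sym_group d\<^esub> w) = \<chi> v * \<chi> w" if "v \<in> W" "w \<in> W" for v w
    using assms(2) that by (auto simp: one_dim_character_def hom_def)
  \<comment> \<open>The value at the identity is a nonzero idempotent of a field, hence 1.\<close>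
  have "\<chi> \<one>\<^bsub>sym_group d\<^esub> \<noteq> 0"
    using assms(2) W.one_closed by (auto simp: one_dim_character_def hom_def)
  then have one: "\<chi> \<one>\<^bsub>sym_group d\<^esub> = 1"
    using mult[OF W.one_closed W.one_closed] by simp
  obtain I A where IA: "matrix_rep (sym_group d) (I :: (nat \<Rightarrow> nat) set) A"
    "\<And>\<sigma>. \<sigma> \<in> carrier (sym_group d) \<Longrightarrow> S.induced W \<chi> \<sigma> = (\<Sum>i\<in>I. A \<sigma> i i)"
    by (rule S.induced_eq_matrix_trace[OF finite_carrier_sym_group assms(1), of \<chi>])
      (rule mult, assumption, assumption, rule one, rule that)
  then have "(\<lambda>\<sigma>\<in>carrier (sym_group d). S.induced W \<chi> \<sigma>) =
      (\<lambda>\<sigma>\<in>carrier (sym_group d). \<Sum>i\<in>I. A \<sigma> i i)"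
    by (intro restrict_ext) simp
  then show ?thesis using matrix_rep_trace_sym_characters[OF IA(1)] by simp
qed

lemma mfps_const_1: "mfps_const 1 = 1"
  by (rule mfps_eqI) (simp add: mfps_const.rep_eq one_mfps.rep_eq)

lemma cycle_monomial_conjugate:
  assumes "a permutes {1..d}" "\<tau> permutes {1..d}" "a \<circ> \<tau> = \<sigma> \<circ> a"
  shows "cycle_monomial d \<sigma> = cycle_monomial d \<tau>"
  using cycle_count_conjugate[OF assms] by (simp add: cycle_monomial_def)

text \<open>After exchanging the two sums, the substitution \<sigma> to its conjugate by
  \<open>a\<close> keeps the cycle monomial, so the inner sum is the same for all \<open>a\<close>.
  The d! equal copies cancel the factor 1/d!.\<close>

lemma cycle_index_eq_characteristic_map:
  fixes \<chi> :: "(nat \<Rightarrow> nat) \<Rightarrow> 'a :: field_char_0"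
  assumes "W \<subseteq> carrier (sym_group d)"
  shows "cycle_index d W \<chi> =
    characteristic_map d (\<lambda>\<sigma>\<in>carrier (sym_group d). group.induced (sym_group d) W \<chi> \<sigma>)"
proof -
  interpret S: group "sym_group d" by (rule sym_group_is_group)
  let ?G = "carrier (sym_group d)"
  let ?E = "S.extend_by_0 W \<chi>"
  let ?conj = "\<lambda>a \<sigma>. inv\<^bsub>sym_group d\<^esub> a \<otimes>\<^bsub>sym_group d\<^esub> \<sigma> \<otimes>\<^bsub>sym_group d\<^esub> a"
  define X where "X = (\<Sum>\<tau>\<in>W. mfps_const (\<chi> \<tau>) * cycle_monomial d \<tau>)"
  have inner: "(\<Sum>\<sigma>\<in>?G. mfps_const (?E (?conj a \<sigma>)) * cycle_monomial d \<sigma>) = X"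
    if a: "a \<in> ?G" for a
  proof -
    have bij: "bij_betw (?conj a) ?G ?G"
      by (rule bij_betw_byWitness[where
            f' = "\<lambda>\<tau>. a \<otimes>\<^bsub>sym_group d\<^esub> \<tau> \<otimes>\<^bsub>sym_group d\<^esub> inv\<^bsub>sym_group d\<^esub> a"])
        (use a in \<open>auto simp del: sym_group_inv_equality
          simp: S.m_assoc S.mult_inv_mult S.inv_mult_mult\<close>)
    have mono: "(cycle_monomial d \<sigma> :: 'a mfps) = cycle_monomial d (?conj a \<sigma>)" if "\<sigma> \<in> ?G" for \<sigma>
    proof (rule cycle_monomial_conjugate)
      show "a permutes {1..d}" using a by (simp add: sym_group_carrier)
      show "?conj a \<sigma> permutes {1..d}"
        using a that unfolding sym_group_carrier[symmetric]
        by (simp del: sym_group_inv_equality)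
      have "a \<otimes>\<^bsub>sym_group d\<^esub> ?conj a \<sigma> = \<sigma> \<otimes>\<^bsub>sym_group d\<^esub> a"
        using a that by (simp add: S.m_assoc S.mult_inv_mult del: sym_group_inv_equality)
      then show "a \<circ> ?conj a \<sigma> = \<sigma> \<circ> a"
        unfolding sym_group_mult .
    qed
    have "(\<Sum>\<sigma>\<in>?G. mfps_const (?E (?conj a \<sigma>)) * cycle_monomial d \<sigma>) =
        (\<Sum>\<sigma>\<in>?G. mfps_const (?E (?conj a \<sigma>)) * cycle_monomial d (?conj a \<sigma>))"
      using mono by (intro sum.cong) simp_all
    also have "\<dots> = (\<Sum>\<tau>\<in>?G. mfps_const (?E \<tau>) * cycle_monomial d \<tau>)"
      by (rule sum.reindex_bij_betw[OF bij])
    also have "\<dots> = (\<Sum>\<tau>\<in>W. mfps_const (?E \<tau>) * cycle_monomial d \<tau>)"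
      using assms by (intro sum.mono_neutral_right) (auto simp: S.extend_by_0_def mfps_const_0)
    also have "\<dots> = X"
      unfolding X_def by (intro sum.cong) (auto simp: S.extend_by_0_def)
    finally show ?thesis .
  qed
  have "mfps_const (S.induced W \<chi> \<sigma>) * cycle_monomial d \<sigma> = (\<Sum>a\<in>?G.
      mfps_const (1 / of_nat (card W)) * (mfps_const (?E (?conj a \<sigma>)) * cycle_monomial d \<sigma>))" for \<sigma>
    unfolding S.induced_def mfps_const_mult mfps_const_sum
    by (simp only: sum_distrib_left sum_distrib_right mult.assoc)
  then have "characteristic_map d (\<lambda>\<sigma>\<in>?G. S.induced W \<chi> \<sigma>) =
      mfps_const (1 / fact d) * (\<Sum>\<sigma>\<in>?G. \<Sum>a\<in>?G.
        mfps_const (1 / of_nat (card W)) * (mfps_const (?E (?conj a \<sigma>)) * cycle_monomial d \<sigma>))"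
    by (simp add: characteristic_map_def del: sym_group_inv_equality)
  also have "\<dots> = mfps_const (1 / fact d) * (\<Sum>a\<in>?G. mfps_const (1 / of_nat (card W)) * X)"
    using inner by (subst sum.swap) (simp add: sum_distrib_left[symmetric])
  also have "\<dots> = (\<Sum>a\<in>?G. mfps_const (1 / fact d)) * (mfps_const (1 / of_nat (card W)) * X)"
    by (simp add: sum_distrib_left sum_distrib_right)
  also have "(\<Sum>a\<in>?G. mfps_const (1 / fact d)) = (1 :: 'a mfps)"
    by (simp add: mfps_const_sum[symmetric] card_carrier_sym_group mfps_const_1 del: sum_constant)
      (simp add: card_carrier_sym_group mfps_const_1)
  finally show ?thesis
    unfolding cycle_index_def X_def mult_1_left by (rule sym)
qed

section \<open>Automorphism groups of graphs and of superpositions\<close>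

lemma subgroup_aut_group: "subgroup (aut_group d \<Gamma>) (sym_group d)"
proof -
  interpret S: group "sym_group d" by (rule sym_group_is_group)
  show ?thesis
  proof (rule S.subgroupI)
    show "aut_group d \<Gamma> \<subseteq> carrier (sym_group d)" by (auto simp: aut_group_def)
    have "id \<in> aut_group d \<Gamma>"
      using S.one_closed by (simp add: aut_group_def sym_group_one uprod.map_id)
    then show "aut_group d \<Gamma> \<noteq> {}" by blast
  next
    fix \<sigma> assume \<sigma>: "\<sigma> \<in> aut_group d \<Gamma>"
    then have G: "\<sigma> \<in> carrier (sym_group d)" by (simp add: aut_group_def)
    have "count \<Gamma> (map_uprod (inv' \<sigma>) e) = count \<Gamma> e" for e
    proof -
      have "count \<Gamma> (map_uprod \<sigma> (map_uprod (inv' \<sigma>) e)) = count \<Gamma> (map_uprod (inv' \<sigma>) e)"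
        using \<sigma> by (simp add: aut_group_def)
      moreover have "map_uprod \<sigma> (map_uprod (inv' \<sigma>) e) = e"
        using G by (simp add: uprod.map_comp permutes_inv_o sym_group_carrier uprod.map_id)
      ultimately show ?thesis by simp
    qed
    then show "inv\<^bsub>sym_group d\<^esub> \<sigma> \<in> aut_group d \<Gamma>"
      using G by (simp add: aut_group_def sym_group_inv_closed)
  next
    fix \<sigma> \<tau> assume "\<sigma> \<in> aut_group d \<Gamma>" "\<tau> \<in> aut_group d \<Gamma>"
    then show "\<sigma> \<otimes>\<^bsub>sym_group d\<^esub> \<tau> \<in> aut_group d \<Gamma>"
      using S.m_closed[of \<sigma> \<tau>]
      by (simp add: aut_group_def sym_group_mult uprod.map_comp[symmetric])
  qed
qed

lemma superposition_aut_eq_common_stabilizer: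
  assumes "k \<ge> 1" and W: "\<And>m. m \<in> {1..k} \<Longrightarrow> W m \<subseteq> carrier (sym_group d)"
    and a: "a \<in> placements d k"
  shows "superposition_aut k W a = group.common_stabilizer (sym_group d) {1..k} W a"
proof -
  interpret S: group "sym_group d" by (rule sym_group_is_group)
  have aG: "a m \<in> carrier (sym_group d)" if "m \<in> {1..k}" for m
    using a that by (auto simp: placements_def)
  have conj: "g \<in> (\<lambda>w. a m \<circ> w \<circ> inv' (a m)) ` W m \<longleftrightarrow>
      g \<in> carrier (sym_group d) \<and>
      inv\<^bsub>sym_group d\<^esub> a m \<otimes>\<^bsub>sym_group d\<^esub> g \<otimes>\<^bsub>sym_group d\<^esub> a m \<in> W m" if m: "m \<in> {1..k}" for m g
  proof -
    let ?f = "\<lambda>w. a m \<otimes>\<^bsub>sym_group d\<^esub> w \<otimes>\<^bsub>sym_group d\<^esub> inv\<^bsub>sym_group d\<^esub> a m"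
    let ?h = "\<lambda>g. inv\<^bsub>sym_group d\<^esub> a m \<otimes>\<^bsub>sym_group d\<^esub> g \<otimes>\<^bsub>sym_group d\<^esub> a m"
    \<comment> \<open>This rule would rewrite the group inverse into the inverse function, to which
      the cancellation laws of the group do not apply.\<close>
    note [simp del] = sym_group_inv_equality
    have "?h (?f w) = w" "?f w \<in> carrier (sym_group d)" if "w \<in> W m" for w
      using aG[OF m] W[OF m] that
      by (auto simp: S.m_assoc S.inv_mult_mult subset_iff)
    moreover have "?f (?h g) = g" if "g \<in> carrier (sym_group d)" for g
      using aG[OF m] that by (simp add: S.m_assoc S.mult_inv_mult)
    ultimately have "g \<in> ?f ` W m \<longleftrightarrow> g \<in> carrier (sym_group d) \<and> ?h g \<in> W m"
      by (metis (no_types, lifting) image_iff)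
    then show ?thesis
      using sym_group_inv_equality[OF aG[OF m]] by (simp add: sym_group_mult)
  qed
  \<comment> \<open>With an index at hand, members of the intersection are permutations in the
    symmetric group, as \<open>common_stabilizer\<close> requires explicitly; an empty intersection
    would be the whole type.\<close>
  have "1 \<in> {1..k}" using assms(1) by simp
  then show ?thesis
    unfolding superposition_aut_def S.common_stabilizer_def using conj by blast
qed

theorem corollary3p1p3:
  fixes d k :: nat
    and \<Gamma> :: "nat \<Rightarrow> nat uprod multiset"
    and W :: "nat \<Rightarrow> (nat \<Rightarrow> nat) set"
    and \<rho> :: "(nat \<Rightarrow> nat) \<Rightarrow> 'k :: {alg_closed_field, field_char_0}"
  assumes "d \<ge> 1" and "k \<ge> 1"
    and "\<And>m. m \<in> {1..k} \<Longrightarrow> multigraph d (\<Gamma> m)"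
    and "\<And>m. m \<in> {1..k} \<Longrightarrow> W m = aut_group d (\<Gamma> m)"
    and "cyclic_group (sym_group d\<lparr>carrier := W 1\<rparr>)"
    and "one_dim_character d (W 1) \<rho>"
    and "inj_on \<rho> (W 1)"
  shows "of_nat (card (asymmetric_superpositions d k W)) =
    coeff_sum (power_sum_polynomial d
      (foldl (internal_product d) (cycle_index d (W 1) \<rho>)
        (map (\<lambda>m. cycle_index d (W m) (\<lambda>_. 1)) [2..<k + 1])))"
proof -
  interpret S: group "sym_group d" by (rule sym_group_is_group)
  let ?G = "carrier (sym_group d)"
  let ?P = "\<Pi>\<^sub>E m\<in>{1..k}. ?G"
  let ?free = "\<lambda>a. S.common_stabilizer {1..k} W a = {\<one>\<^bsub>sym_group d\<^esub>}"
  \<comment> \<open>A single family of characters, so that \<rho> and the trivial characters pass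
    through the same lemmas.\<close>
  define \<chi> :: "nat \<Rightarrow> (nat \<Rightarrow> nat) \<Rightarrow> 'k" where "\<chi> m = (if m = 1 then \<rho> else (\<lambda>_. 1))" for m
  define u where "u m = (\<lambda>\<sigma>\<in>?G. S.induced (W m) (\<chi> m) \<sigma>)" for m
  define w :: 'k where "w = (\<Prod>m\<in>{1..k}. of_nat (card (W m)))"
  have sub: "subgroup (W m) (sym_group d)" if "m \<in> {1..k}" for m
    using assms(4)[OF that] subgroup_aut_group by simp
  have WG: "W m \<subseteq> ?G" if "m \<in> {1..k}" for m
    using sub[OF that] by (rule subgroup.subset)
  have k1: "1 \<in> {1..k}" using assms(2) by simp
  \<comment> \<open>The list in the statement runs through 2, ..., \<open>k\<close> and is empty for
    \<open>k = 1\<close>.\<close>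
  have J: "{1..k} = insert 1 {2..<k + 1}" using assms(2) by auto
  have "one_dim_character d (W m) (\<chi> m)" for m
    using assms(6) by (simp add: \<chi>_def one_dim_character_def hom_def)
  then have char: "u m \<in> sym_characters d" if "m \<in> {1..k}" for m
    unfolding u_def using sub[OF that] by (intro induced_sym_characters)
  have index: "cycle_index d (W m) (\<chi> m) = characteristic_map d (u m)" if "m \<in> {1..k}" for m
    unfolding u_def using WG[OF that] by (rule cycle_index_eq_characteristic_map)
  have "cycle_index d (W m) (\<lambda>_. 1) = characteristic_map d (u m)" if "m \<in> set [2..<k + 1]" for m
  proof -
    have "m \<in> {1..k}" "m \<noteq> 1" using that by auto
    then show ?thesis using index[of m] by (simp add: \<chi>_def)
  qed
  then have "map (\<lambda>m. cycle_index d (W m) (\<lambda>_. 1)) [2..<k + 1] =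
      map (\<lambda>m. characteristic_map d (u m)) [2..<k + 1]"
    by (rule map_cong[OF refl])
  moreover have "cycle_index d (W 1) \<rho> = characteristic_map d (u 1)"
    using index[OF k1] by (simp add: \<chi>_def)
  ultimately have "foldl (internal_product d) (cycle_index d (W 1) \<rho>)
        (map (\<lambda>m. cycle_index d (W m) (\<lambda>_. 1)) [2..<k + 1]) =
      foldl (internal_product d) (characteristic_map d (u 1))
        (map (\<lambda>m. characteristic_map d (u m)) [2..<k + 1])"
    by (simp only:)
  also have "\<dots> = characteristic_map d (\<lambda>\<sigma>\<in>?G. u 1 \<sigma> * (\<Prod>m\<leftarrow>[2..<k + 1]. u m \<sigma>))"
    using char k1 by (intro foldl_internal_product) auto
  also have "(\<lambda>\<sigma>\<in>?G. u 1 \<sigma> * (\<Prod>m\<leftarrow>[2..<k + 1]. u m \<sigma>)) =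
      (\<lambda>\<sigma>\<in>?G. \<Prod>m\<in>{1..k}. S.induced (W m) (\<chi> m) \<sigma>)"
  proof (rule restrict_ext)
    fix \<sigma> assume \<sigma>: "\<sigma> \<in> ?G"
    have "(\<Prod>m\<leftarrow>[2..<k + 1]. u m \<sigma>) = (\<Prod>m\<in>{2..<k + 1}. u m \<sigma>)"
      using prod.distinct_set_conv_list[OF distinct_upt, of "\<lambda>m. u m \<sigma>" 2 "k + 1"]
      by (simp only: set_upt)
    moreover have "(\<Prod>m\<in>{1..k}. S.induced (W m) (\<chi> m) \<sigma>) = u 1 \<sigma> * (\<Prod>m\<in>{2..<k + 1}. u m \<sigma>)"
      unfolding J using \<sigma> by (subst prod.insert) (simp_all add: u_def)
    ultimately show "u 1 \<sigma> * (\<Prod>m\<leftarrow>[2..<k + 1]. u m \<sigma>) =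
        (\<Prod>m\<in>{1..k}. S.induced (W m) (\<chi> m) \<sigma>)"
      by (simp only:)
  qed
  finally have "coeff_sum (power_sum_polynomial d
      (foldl (internal_product d) (cycle_index d (W 1) \<rho>)
        (map (\<lambda>m. cycle_index d (W m) (\<lambda>_. 1)) [2..<k + 1]))) =
      (\<Sum>\<sigma>\<in>?G. \<Prod>m\<in>{1..k}. S.induced (W m) (\<chi> m) \<sigma>) / fact d" (is "?rhs = _")
    by (simp add: power_sum_polynomial_characteristic_map coeff_sum_char_polynomial)
  \<comment> \<open>Distributivity turns the product over \<open>m\<close> of sums over the group
    into a sum over all placements, and \<open>w\<close> collects the denominators.\<close>
  also have "(\<Sum>\<sigma>\<in>?G. \<Prod>m\<in>{1..k}. S.induced (W m) (\<chi> m) \<sigma>) =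
      (\<Sum>\<sigma>\<in>?G. \<Sum>a\<in>?P. (\<Prod>m\<in>{1..k}. S.extend_by_0 (W m) (\<chi> m)
        (inv\<^bsub>sym_group d\<^esub> a m \<otimes>\<^bsub>sym_group d\<^esub> \<sigma> \<otimes>\<^bsub>sym_group d\<^esub> a m)) / w)"
  proof (rule sum.cong[OF refl])
    fix \<sigma>
    show "(\<Prod>m\<in>{1..k}. S.induced (W m) (\<chi> m) \<sigma>) =
      (\<Sum>a\<in>?P. (\<Prod>m\<in>{1..k}. S.extend_by_0 (W m) (\<chi> m)
        (inv\<^bsub>sym_group d\<^esub> a m \<otimes>\<^bsub>sym_group d\<^esub> \<sigma> \<otimes>\<^bsub>sym_group d\<^esub> a m)) / w)"
      unfolding S.induced_def prod.distrib w_def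
      by (subst prod_sum_PiE) (simp_all add: prod_dividef sum_divide_distrib
          del: sym_group_inv_equality)
  qed
  also have "\<dots> = (\<Sum>a\<in>?P. (\<Sum>\<sigma>\<in>?G. \<Prod>m\<in>{1..k}. S.extend_by_0 (W m) (\<chi> m)
        (inv\<^bsub>sym_group d\<^esub> a m \<otimes>\<^bsub>sym_group d\<^esub> \<sigma> \<otimes>\<^bsub>sym_group d\<^esub> a m)) / w)"
    by (subst sum.swap) (simp add: sum_divide_distrib del: sym_group_inv_equality)
  also have "\<dots> = (\<Sum>a\<in>?P. (if ?free a then 1 else 0) / w)"
  proof (rule sum.cong[OF refl])
    fix a assume a: "a \<in> ?P"
    have mult: "\<chi> 1 (v \<otimes>\<^bsub>sym_group d\<^esub> w) = \<chi> 1 v * \<chi> 1 w" if "v \<in> W 1" "w \<in> W 1" for v w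
      using assms(6) that by (auto simp: \<chi>_def one_dim_character_def hom_def)
    have one_in: "\<one>\<^bsub>sym_group d\<^esub> \<in> W 1"
      using sub[OF k1] by (rule subgroup.one_closed)
    then have "\<rho> \<one>\<^bsub>sym_group d\<^esub> \<noteq> 0"
      using assms(6) by (auto simp: one_dim_character_def hom_def)
    then have one: "\<chi> 1 \<one>\<^bsub>sym_group d\<^esub> = 1"
      using mult[OF one_in one_in] by (simp add: \<chi>_def)
    have "(\<Sum>\<sigma>\<in>?G. \<Prod>m\<in>{1..k}. S.extend_by_0 (W m) (\<chi> m)
        (inv\<^bsub>sym_group d\<^esub> a m \<otimes>\<^bsub>sym_group d\<^esub> \<sigma> \<otimes>\<^bsub>sym_group d\<^esub> a m)) = (if ?free a then 1 else 0)"
    proof (rule S.sum_prod_extend_by_0[OF finite_carrier_sym_group _ k1])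
      show "a m \<in> ?G" if "m \<in> {1..k}" for m using a that by auto
      show "inj_on (\<chi> 1) (W 1)" using assms(7) by (simp add: \<chi>_def)
    qed (use sub one mult in \<open>auto simp: \<chi>_def\<close>)
    then show "(\<Sum>\<sigma>\<in>?G. \<Prod>m\<in>{1..k}. S.extend_by_0 (W m) (\<chi> m)
        (inv\<^bsub>sym_group d\<^esub> a m \<otimes>\<^bsub>sym_group d\<^esub> \<sigma> \<otimes>\<^bsub>sym_group d\<^esub> a m)) / w =
      (if ?free a then 1 else 0) / w"
      by (simp only:)
  qed
  also have "\<dots> = of_nat (card {a \<in> ?P. ?free a}) / w"
    by (simp add: sum_divide_distrib[symmetric] sum.If_cases finite_PiE Int_def)
  \<comment> \<open>Each asymmetric superposition has d! times \<Prod> |W m| representatives,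
    exactly the two denominators that remain.\<close>
  also have "card {a \<in> ?P. ?free a} =
      card {C \<in> ?P // S.double_coset_rel {1..k} W. \<forall>a\<in>C. ?free a} *
        (card ?G * (\<Prod>m\<in>{1..k}. card (W m)))"
    using k1 by (intro S.card_free_double_cosets[symmetric] sub) auto
  also have "{C \<in> ?P // S.double_coset_rel {1..k} W. \<forall>a\<in>C. ?free a} =
      asymmetric_superpositions d k W"
  proof -
    have rel: "superposition_rel d k W = S.double_coset_rel {1..k} W"
      by (simp add: superposition_rel_def S.double_coset_rel_def placements_def sym_group_mult)
    \<comment> \<open>The identification of the two automorphism groups holds for placements, so
      members of a class must be known to be placements.\<close>
    have P: "a \<in> placements d k" if "C \<in> placements d k // superposition_rel d k W" "a \<in> C" for C a
      using that by (auto simp: quotient_def superposition_rel_def)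
    have aut: "superposition_aut k W a = S.common_stabilizer {1..k} W a" if "a \<in> placements d k" for a
      using superposition_aut_eq_common_stabilizer[OF assms(2) WG that] .
    have "C \<in> superpositions d k W \<Longrightarrow>
        (\<forall>a\<in>C. superposition_aut k W a = {id}) \<longleftrightarrow> (\<forall>a\<in>C. ?free a)" for C
      using aut P by (simp add: superpositions_def sym_group_one)
    moreover have "?P // S.double_coset_rel {1..k} W = superpositions d k W"
      by (simp add: superpositions_def rel placements_def)
    ultimately show ?thesis
      unfolding asymmetric_superpositions_def by (simp cong: conj_cong)
  qed
  finally have "?rhs = of_nat (card (asymmetric_superpositions d k W)) * fact d * w / w / fact d"
    by (simp add: card_carrier_sym_group w_def mult.assoc)
  \<comment> \<open>The groups are finite and nonempty, and characteristic zero keeps their orders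
    nonzero in the field.\<close>
  moreover have "w \<noteq> 0"
  proof -
    have "card (W m) \<noteq> 0" if "m \<in> {1..k}" for m
      using subgroup.one_closed[OF sub[OF that]] finite_subset[OF WG[OF that]] by auto
    then show ?thesis by (simp add: w_def)
  qed
  ultimately show ?thesis by simp
qed

end
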